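(* Let $G$ be a finitely generated nilpotent group, and consider the quotient map $\pi\colon G\twoheadrightarrow G/I_G([G,G])\simeq\mathbb Z^r$, where $r\ge 1$. For any set $S\subseteq G$, the following are equivalent: (1) $\mathrm{Conv}(\pi(S))\subseteq\mathbb R^r$ contains a ball $B(\mathbf 0,\varepsilon)$ for some $\varepsilon>0$. (2) For every non-zero linear form $f\colon\mathbb Z^r\to\mathbb R$, there exists $s\in S$ such that $f(\pi(s))<0$. (If $S$ is finite, one can restrict to non-zero linear forms $f\colon\mathbb Z^r\to\mathbb Z$, i.e. the condition for such $f$ only is also equivalent.) (3) For every non-zero homomorphism $\phi\colon G\to\mathbb R$, there exists $s\in S$ such that $\phi(s)<0$. (4) The subsemigroup $S^+$ is a finite-index subgroup of $G$.
   Context: For a group $G$, $I_G([G,G]):=\{g\in G\mid \exists n\in\mathbb N^+,\ g^n\in[G,G]\}$ is the isolator of $[G,G]$; $G/I_G([G,G])$ is the largest torsion-free abelian quotient of $G$, and for finitely generated $G$ it is isomorphic to $\mathbb Z^r$, with $r$ the torsion-free rank of the abelianisation of $G$. Fix such an isomorphism and regard $\mathbb Z^r\subset\mathbb R^r$. A linear form $f\colon \mathbb Z^r\to\mathbb R$ is the restriction of a linear functional on $\mathbb R^r$ (equivalently, an additive homomorphism). $\mathrm{Conv}(A)$ is the convex hull of $A$ in $\mathbb R^r$ and $B(\mathbf 0,\varepsilon)$ is the ball of radius $\varepsilon$ centred at the origin. $S^+$ is the subsemigroup of $G$ generated by $S$, i.e. all products of $\ell\ge1$ elements of $S$ (empty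 if $S=\emptyset$). *)

theory Defs
  imports "HOL-Analysis.Analysis" "HOL-Algebra.Generated_Groups" "HOL-Algebra.Coset"
begin

definition finitely_generated_group :: "('a, 'b) monoid_scheme \<Rightarrow> bool" where
  "finitely_generated_group G \<longleftrightarrow>
     group G \<and> (\<exists>A. finite A \<and> A \<subseteq> carrier G \<and> generate G A = carrier G)"

primrec lower_central :: "('a, 'b) monoid_scheme \<Rightarrow> nat \<Rightarrow> 'a set" where
  "lower_central G 0 = carrier G"
| "lower_central G (Suc n) = generate G
     {x \<otimes>\<^bsub>G\<^esub> g \<otimes>\<^bsub>G\<^esub> inv\<^bsub>G\<^esub> x \<otimes>\<^bsub>G\<^esub> inv\<^bsub>G\<^esub> g | x g. x \<in> lower_central G n \<and> g \<in> carrier G}"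

definition nilpotent_group :: "('a, 'b) monoid_scheme \<Rightarrow> bool" where
  "nilpotent_group G \<longleftrightarrow> group G \<and> (\<exists>n. lower_central G n = {\<one>\<^bsub>G\<^esub>})"

definition isolator :: "('a, 'b) monoid_scheme \<Rightarrow> 'a set \<Rightarrow> 'a set" where
  "isolator G H = {g \<in> carrier G. \<exists>n::nat. n > 0 \<and> g [^]\<^bsub>G\<^esub> n \<in> H}"

text \<open>\<^term>\<open>derived G (carrier G)\<close> is the commutator subgroup $[G,G]$.\<close>

abbreviation commutator_isolator :: "('a, 'b) monoid_scheme \<Rightarrow> 'a set" where
  "commutator_isolator G \<equiv> isolator G (derived G (carrier G))"

definition additive_group :: "'a::ab_group_add monoid" where
  "additive_group = \<lparr>carrier = UNIV, monoid.mult = (+), one = 0\<rparr>"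

text \<open>The group $\mathbb{Z}^r$ is \<^term>\<open>additive_group :: (int ^ 'r) monoid\<close> with
  $r$ the cardinality of the finite index type, so that $r \geq 1$ automatically. The next
  definition composes the canonical projection with a chosen identification
  \<open>\<psi>\<close> of the quotient with $\mathbb{Z}^r$.\<close>

definition quotient_map ::
  "('a, 'b) monoid_scheme \<Rightarrow> ('a set \<Rightarrow> int ^ 'r) \<Rightarrow> 'a \<Rightarrow> int ^ 'r" where
  "quotient_map G \<psi> g = \<psi> (commutator_isolator G #>\<^bsub>G\<^esub> g)"

definition real_vec :: "int ^ 'r \<Rightarrow> real ^ 'r" where
  "real_vec v = (\<chi> i. real_of_int (v $ i))"

definition linear_form :: "(int ^ 'r \<Rightarrow> real) \<Rightarrow> bool" where
  "linear_form f \<longleftrightarrow> (\<exists>L :: real ^ 'r \<Rightarrow> real. linear L \<and> (\<forall>v. f v = L (real_vec v)))"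

inductive_set subsemigroup_generated :: "('a, 'b) monoid_scheme \<Rightarrow> 'a set \<Rightarrow> 'a set"
  for G and S where
  incl: "s \<in> S \<Longrightarrow> s \<in> subsemigroup_generated G S"
| mult: "x \<in> subsemigroup_generated G S \<Longrightarrow> y \<in> subsemigroup_generated G S
         \<Longrightarrow> x \<otimes>\<^bsub>G\<^esub> y \<in> subsemigroup_generated G S"

definition finite_index_subgroup :: "'a set \<Rightarrow> ('a, 'b) monoid_scheme \<Rightarrow> bool" where
  "finite_index_subgroup H G \<longleftrightarrow> subgroup H G \<and> finite (rcosets\<^bsub>G\<^esub> H)"

definition cond_ball ::
  "('a, 'b) monoid_scheme \<Rightarrow> ('a set \<Rightarrow> int ^ 'r) \<Rightarrow> 'a set \<Rightarrow> bool" where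
  "cond_ball G \<psi> S \<longleftrightarrow>
     (\<exists>\<epsilon>>0. ball (0 :: real ^ 'r) \<epsilon> \<subseteq> convex hull (real_vec ` quotient_map G \<psi> ` S))"

definition cond_real_forms ::
  "('a, 'b) monoid_scheme \<Rightarrow> ('a set \<Rightarrow> int ^ 'r) \<Rightarrow> 'a set \<Rightarrow> bool" where
  "cond_real_forms G \<psi> S \<longleftrightarrow>
     (\<forall>f :: int ^ 'r \<Rightarrow> real. linear_form f \<and> (\<exists>v. f v \<noteq> 0) \<longrightarrow>
        (\<exists>s\<in>S. f (quotient_map G \<psi> s) < 0))"

definition cond_int_forms ::
  "('a, 'b) monoid_scheme \<Rightarrow> ('a set \<Rightarrow> int ^ 'r) \<Rightarrow> 'a set \<Rightarrow> bool" where
  "cond_int_forms G \<psi> S \<longleftrightarrow>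
     (\<forall>f :: int ^ 'r \<Rightarrow> int. linear_form (\<lambda>v. real_of_int (f v)) \<and> (\<exists>v. f v \<noteq> 0) \<longrightarrow>
        (\<exists>s\<in>S. f (quotient_map G \<psi> s) < 0))"

definition cond_homs :: "('a, 'b) monoid_scheme \<Rightarrow> 'a set \<Rightarrow> bool" where
  "cond_homs G S \<longleftrightarrow>
     (\<forall>\<phi> \<in> hom G (additive_group :: real monoid). (\<exists>g\<in>carrier G. \<phi> g \<noteq> 0) \<longrightarrow>
        (\<exists>s\<in>S. \<phi> s < 0))"

end

theory Submission
  imports Defs "HOL-Analysis.Kronecker_Approximation_Theorem"
begin

text \<open>
  The main point is that (3) implies (4). Let \<open>L\<close> be \<open>S\<^sup>+\<close> with the identity adjoined and let
  \<open>\<gamma>\<^sub>n\<close> be the lower central series. One shows by induction on \<open>n\<close> that \<open>L \<gamma>\<^sub>n\<close> is a subgroup of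
  finite index. For the step it suffices that \<open>C = L \<gamma>\<^sub>n\<^sub>+\<^sub>1 \<inter> \<gamma>\<^sub>n\<close> has finite index in \<open>\<gamma>\<^sub>n\<close>, which
  is finitely generated and abelian modulo \<open>\<gamma>\<^sub>n\<^sub>+\<^sub>1 \<subseteq> C\<close>. In a finitely generated abelian group, a
  submonoid without positive powers of some \<open>g\<close> admits a non-zero additive real function that is
  non-negative on it: start with \<open>g \<mapsto> -1\<close> and extend to one generator at a time, as in the
  Hahn-Banach theorem. So one needs that an additive \<open>f\<close> on \<open>\<gamma>\<^sub>n\<close> that is non-negative on \<open>C\<close> is zero.
  For \<open>n = 0\<close> this is (3). For \<open>n > 0\<close> take \<open>a \<in> \<gamma>\<^sub>n\<^sub>-\<^sub>1\<close> and \<open>b\<close> in \<open>L \<gamma>\<^sub>n\<^sub>+\<^sub>1\<close>, with inverses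
  \<open>a'\<close>, \<open>b'\<close> modulo \<open>\<gamma>\<^sub>n\<close> in this monoid. Then \<open>a\<^sup>k b\<^sup>k a'\<^sup>k b'\<^sup>k\<close> lies in \<open>C\<close> and \<open>f\<close> takes the value
  \<open>k\<^sup>2 f [a, b] + k c\<close> there, with \<open>c\<close> independent of \<open>k\<close>; hence \<open>f [a, b] \<ge> 0\<close>, and replacing
  \<open>a\<close> by \<open>a'\<close> gives \<open>f [a, b] = 0\<close>.

  For finite \<open>S\<close>, a real form that is non-negative on \<open>\<pi>(S)\<close> is rounded to an integral one by
  simultaneous Dirichlet approximation: the error on \<open>\<pi>(S)\<close> is less than 1, and an integer greater
  than \<open>-1\<close> is non-negative.
\<close>

section \<open>Additive real functions on abelian groups\<close>

definition additive_on :: "('a, 'b) monoid_scheme \<Rightarrow> 'a set \<Rightarrow> ('a \<Rightarrow> real) \<Rightarrow> bool" where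
  "additive_on G B f \<longleftrightarrow> (\<forall>x\<in>B. \<forall>y\<in>B. f (x \<otimes>\<^bsub>G\<^esub> y) = f x + f y)"

text \<open>This is \<open>cond_homs\<close> in contrapositive form, with the domain
  \<open>B\<close> left free so that it can be required of each term of the lower central
  series.\<close>

definition unbiased :: "('a, 'b) monoid_scheme \<Rightarrow> 'a set \<Rightarrow> 'a set \<Rightarrow> bool" where
  "unbiased G B C \<longleftrightarrow>
     (\<forall>f. additive_on G B f \<longrightarrow> (\<forall>x\<in>C. 0 \<le> f x) \<longrightarrow> (\<forall>x\<in>B. f x = 0))"

lemma unbiasedI:
  "(\<And>f x. additive_on G B f \<Longrightarrow> (\<And>x. x \<in> C \<Longrightarrow> 0 \<le> f x) \<Longrightarrow> x \<in> B \<Longrightarrow> f x = 0) \<Longrightarrow> unbiased G B C"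
  by (auto simp: unbiased_def)

lemma unbiasedD:
  "unbiased G B C \<Longrightarrow> additive_on G B f \<Longrightarrow> (\<And>x. x \<in> C \<Longrightarrow> 0 \<le> f x) \<Longrightarrow> x \<in> B \<Longrightarrow> f x = 0"
  by (auto simp: unbiased_def)

lemma additive_onD:
  "additive_on G B f \<Longrightarrow> x \<in> B \<Longrightarrow> y \<in> B \<Longrightarrow> f (x \<otimes>\<^bsub>G\<^esub> y) = f x + f y"
  by (simp add: additive_on_def)

lemma additive_on_mono: "additive_on G B f \<Longrightarrow> A \<subseteq> B \<Longrightarrow> additive_on G A f"
  by (auto simp: additive_on_def)

context group
begin

lemma subgroup_nat_pow_closed: "subgroup H G \<Longrightarrow> x \<in> H \<Longrightarrow> x [^] (n::nat) \<in> H"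
  by (metis int_pow_int subgroup_int_pow_closed)

lemma submonoid_nat_pow_closed:
  assumes "submonoid C G" "x \<in> C"
  shows "x [^] (n::nat) \<in> C"
  by (induction n) (use assms in \<open>auto intro: submonoid.m_closed submonoid.one_closed\<close>)

lemma additive_on_one:
  assumes "additive_on G B f" "subgroup B G"
  shows "f \<one> = 0"
  using additive_onD[OF assms(1), of \<one> \<one>] subgroup.one_closed[OF assms(2)] by simp

lemma additive_on_inv:
  assumes "additive_on G B f" "subgroup B G" "x \<in> B"
  shows "f (inv x) = - f x"
proof -
  have "f (x \<otimes> inv x) = f x + f (inv x)"
    using assms by (intro additive_onD[OF assms(1)]) (auto intro: subgroup.m_inv_closed)
  then show ?thesis
    using assms additive_on_one[OF assms(1,2)] subgroup.mem_carrier[OF assms(2,3)] by simp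
qed

lemma additive_on_nat_pow:
  assumes "additive_on G B f" "subgroup B G" "x \<in> B"
  shows "f (x [^] (n::nat)) = real n * f x"
proof (induction n)
  case 0
  then show ?case using additive_on_one[OF assms(1,2)] by simp
next
  case (Suc n)
  have "x [^] n \<in> B"
    using subgroup_nat_pow_closed[OF assms(2,3)] .
  then show ?case
    using Suc additive_onD[OF assms(1), of "x [^] n" x] assms(3) by (simp add: algebra_simps)
qed

end

section \<open>Adjoining one element to the domain of an additive function\<close>

context comm_group
begin

text \<open>For a subgroup \<open>B\<close> this is the subgroup generated by \<open>B\<close> and
  \<open>a\<close>. The pair \<open>b\<close>, \<open>p\<close> is not unique if a non-zero power of
  \<open>a\<close> lies in \<open>B\<close>, so a function given by such pairs needs a consistency
  proof.\<close>

definition adjoin :: "'a set \<Rightarrow> 'a \<Rightarrow> 'a set" where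
  "adjoin B a = {b \<otimes> a [^] (p::int) | b p. b \<in> B}"

lemma adjoinE:
  assumes "x \<in> adjoin B a"
  obtains b and p :: int where "b \<in> B" "x = b \<otimes> a [^] p"
  using assms by (auto simp: adjoin_def)

lemma adjoinI: "b \<in> B \<Longrightarrow> b \<otimes> a [^] (p::int) \<in> adjoin B a"
  by (auto simp: adjoin_def)

lemma adjoin_mult:
  assumes "x \<in> carrier G" "y \<in> carrier G" "a \<in> carrier G"
  shows "(x \<otimes> a [^] (p::int)) \<otimes> (y \<otimes> a [^] q) = (x \<otimes> y) \<otimes> a [^] (p + q)"
  using assms by (simp add: int_pow_mult m_ac)

lemma adjoin_inv:
  assumes "x \<in> carrier G" "a \<in> carrier G"
  shows "inv (x \<otimes> a [^] (p::int)) = inv x \<otimes> a [^] (- p)"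
  using assms by (simp add: inv_mult int_pow_neg)

lemma adjoin_nat_pow:
  assumes "x \<in> carrier G" "a \<in> carrier G"
  shows "(x \<otimes> a [^] (p::int)) [^] (n::nat) = x [^] n \<otimes> a [^] (p * int n)"
  using assms int_pow_pow[of a p "int n"] by (simp add: nat_pow_distrib int_pow_int)

lemma subgroup_adjoin:
  assumes "subgroup B G" "a \<in> carrier G"
  shows "subgroup (adjoin B a) G"
proof (rule subgroupI)
  note B = subgroup.mem_carrier[OF assms(1)]
  show "adjoin B a \<subseteq> carrier G"
    using assms(2) B by (auto simp: adjoin_def)
  show "adjoin B a \<noteq> {}"
    using subgroup.one_closed[OF assms(1)] by (auto simp: adjoin_def)
  show "inv x \<in> adjoin B a" if "x \<in> adjoin B a" for x
    using that
    by (elim adjoinE) (use assms B in \<open>auto simp: adjoin_inv intro!: adjoinI intro: subgroup.m_inv_closed\<close>)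
  show "x \<otimes> y \<in> adjoin B a" if "x \<in> adjoin B a" "y \<in> adjoin B a" for x y
    using that
    by (elim adjoinE) (use assms B in \<open>auto simp: adjoin_mult intro!: adjoinI intro: subgroup.m_closed\<close>)
qed

lemma adjoin_superset:
  assumes "subgroup B G" "a \<in> carrier G"
  shows "B \<subseteq> adjoin B a" "a \<in> adjoin B a"
proof -
  show "B \<subseteq> adjoin B a"
    using adjoinI[of _ B a 0] subgroup.mem_carrier[OF assms(1)] by fastforce
  show "a \<in> adjoin B a"
    using adjoinI[of \<one> B a 1] subgroup.one_closed[OF assms(1)] assms(2) by simp
qed

text \<open>The extension is forced once \<open>\<tau>\<close> is chosen as its value at
  \<open>a\<close>. The hypothesis \<open>nonneg\<close> ranges over all representations of elements
  of \<open>C\<close>; as \<open>\<one>\<close> is among these elements, it yields consistency as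
  well as non-negativity.\<close>

lemma extend_nonneg_additive:
  fixes f :: "'a \<Rightarrow> real" and \<tau> :: real
  assumes B: "subgroup B G" and a: "a \<in> carrier G" and C: "submonoid C G"
    and f: "additive_on G B f"
    and nonneg: "\<And>b p. b \<in> B \<Longrightarrow> b \<otimes> a [^] (p::int) \<in> C \<Longrightarrow> 0 \<le> f b + of_int p * \<tau>"
  obtains f' where "additive_on G (adjoin B a) f'" "\<And>x. x \<in> adjoin B a \<inter> C \<Longrightarrow> 0 \<le> f' x"
    "\<And>b p. b \<in> B \<Longrightarrow> f' (b \<otimes> a [^] (p::int)) = f b + of_int p * \<tau>"
proof -
  note Bc = subgroup.mem_carrier[OF B]
  \<comment> \<open>A relation between \<open>B\<close> and \<open>a\<close> and its inverse both lie in \<open>C\<close>, so \<open>\<tau>\<close> respects it.\<close>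
  have rel: "f b + of_int p * \<tau> = 0" if b: "b \<in> B" and eq: "b \<otimes> a [^] (p::int) = \<one>" for b p
  proof -
    have "0 \<le> f b + of_int p * \<tau>"
      using nonneg[OF b] eq submonoid.one_closed[OF C] by simp
    moreover have "inv b \<otimes> a [^] (- p) = \<one>"
      using adjoin_inv[of b a p] eq a Bc[OF b] by simp
    then have "0 \<le> f (inv b) + of_int (- p) * \<tau>"
      using nonneg[of "inv b" "- p"] submonoid.one_closed[OF C] subgroup.m_inv_closed[OF B b] by simp
    then have "0 \<le> - (f b + of_int p * \<tau>)"
      using additive_on_inv[OF f B b] by simp
    ultimately show ?thesis by linarith
  qed
  have wd: "f b + of_int p * \<tau> = f c + of_int q * \<tau>"
    if b: "b \<in> B" and c: "c \<in> B" and eq: "b \<otimes> a [^] (p::int) = c \<otimes> a [^] q" for b c p q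
  proof -
    have cB: "inv c \<in> B" using subgroup.m_inv_closed[OF B c] .
    have "(b \<otimes> inv c) \<otimes> a [^] (p + - q) = (b \<otimes> a [^] p) \<otimes> inv (c \<otimes> a [^] q)"
      using adjoin_mult[of b "inv c" a p "- q"] adjoin_inv[of c a q] a Bc[OF b] Bc[OF c] by simp
    also have "\<dots> = \<one>"
      using eq a Bc[OF c] by simp
    finally have "f (b \<otimes> inv c) + of_int (p + - q) * \<tau> = 0"
      using rel subgroup.m_closed[OF B b cB] by blast
    then show ?thesis
      using additive_onD[OF f b cB] additive_on_inv[OF f B c] by (simp add: algebra_simps)
  qed
  define f' where
    "f' x = (SOME t. \<exists>b p. b \<in> B \<and> x = b \<otimes> a [^] (p::int) \<and> t = f b + of_int p * \<tau>)" for x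
  have f'_eq: "f' (b \<otimes> a [^] (p::int)) = f b + of_int p * \<tau>" if b: "b \<in> B" for b p
    unfolding f'_def
  proof (rule some_equality)
    show "\<exists>c q. c \<in> B \<and> b \<otimes> a [^] p = c \<otimes> a [^] (q::int) \<and> f b + of_int p * \<tau> = f c + of_int q * \<tau>"
      using b by blast
    show "t = f b + of_int p * \<tau>"
      if "\<exists>c q. c \<in> B \<and> b \<otimes> a [^] p = c \<otimes> a [^] (q::int) \<and> t = f c + of_int q * \<tau>" for t
      using that wd[OF b] by fastforce
  qed
  have "additive_on G (adjoin B a) f'"
    unfolding additive_on_def
  proof (intro ballI)
    fix x y assume "x \<in> adjoin B a" "y \<in> adjoin B a"
    then obtain b p c q where "b \<in> B" "x = b \<otimes> a [^] (p::int)" "c \<in> B" "y = c \<otimes> a [^] (q::int)"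
      by (metis adjoinE)
    then show "f' (x \<otimes> y) = f' x + f' y"
      using adjoin_mult[of b c a p q] Bc a f'_eq subgroup.m_closed[OF B] additive_onD[OF f]
      by (simp add: algebra_simps)
  qed
  moreover have "0 \<le> f' x" if "x \<in> adjoin B a \<inter> C" for x
    using that nonneg f'_eq by (auto elim!: adjoinE)
  ultimately show ?thesis
    using f'_eq that by blast
qed

text \<open>The Hahn-Banach step. An element \<open>b \<otimes> a [^] p\<close> of \<open>C\<close>
  bounds the value at \<open>a\<close> from below if \<open>p > 0\<close> and from above if
  \<open>p < 0\<close>. Only being non-zero is carried over: the new function need not extend
  \<open>f\<close>.\<close>

lemma adjoin_nonneg_additive_nonzero:
  fixes f :: "'a \<Rightarrow> real"
  assumes B: "subgroup B G" and a: "a \<in> carrier G" and C: "submonoid C G"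
    and f: "additive_on G B f" and nonneg: "\<And>x. x \<in> B \<inter> C \<Longrightarrow> 0 \<le> f x"
    and x0: "x0 \<in> B" "f x0 \<noteq> 0"
  obtains f' x where "additive_on G (adjoin B a) f'" "\<And>x. x \<in> adjoin B a \<inter> C \<Longrightarrow> 0 \<le> f' x"
    "x \<in> adjoin B a" "f' x \<noteq> 0"
proof -
  note result = that
  note Bc = subgroup.mem_carrier[OF B]
  \<comment> \<open>The lower bounds that \<open>C\<close> imposes on the value at
    \<open>a\<close>.\<close>
  define Lo where "Lo = {- f b / of_int p | b p. b \<in> B \<and> p > 0 \<and> b \<otimes> a [^] (p::int) \<in> C}"
  \<comment> \<open>If the constraints on the value at \<open>a\<close> are bounded on one side only, \<open>f\<close> need not extend;
    the function that vanishes on \<open>B\<close> then serves instead.\<close>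
  have one_sided: thesis if \<tau>: "\<tau> \<noteq> 0" "\<And>b p. b \<in> B \<Longrightarrow> b \<otimes> a [^] (p::int) \<in> C \<Longrightarrow> 0 \<le> of_int p * \<tau>"
    for \<tau> :: real
  proof -
    have "additive_on G B (\<lambda>_. 0)" by (simp add: additive_on_def)
    then obtain f' where "additive_on G (adjoin B a) f'" "\<And>x. x \<in> adjoin B a \<inter> C \<Longrightarrow> 0 \<le> f' x"
      and f': "\<And>b p. b \<in> B \<Longrightarrow> f' (b \<otimes> a [^] (p::int)) = 0 + of_int p * \<tau>"
      using extend_nonneg_additive[OF B a C, of "\<lambda>_. 0" \<tau>] \<tau>(2) by auto
    moreover have "f' a \<noteq> 0"
      using f'[of \<one> 1] subgroup.one_closed[OF B] a \<tau>(1) by simp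
    ultimately show thesis
      using adjoin_superset[OF B a] result by blast
  qed
  consider (noneg) "\<And>b p. b \<in> B \<Longrightarrow> b \<otimes> a [^] (p::int) \<in> C \<Longrightarrow> p \<ge> 0"
    | (nopos) "\<And>b p. b \<in> B \<Longrightarrow> b \<otimes> a [^] (p::int) \<in> C \<Longrightarrow> p \<le> 0"
    | (both) b p c q where "b \<in> B" "b \<otimes> a [^] (p::int) \<in> C" "p > 0"
        "c \<in> B" "c \<otimes> a [^] (q::int) \<in> C" "q < 0"
    by (meson not_le)
  then show thesis
  proof cases
    case noneg
    then show thesis using one_sided[of 1] by simp
  next
    case nopos
    then show thesis using one_sided[of "-1"] by simp
  next
    case both
    \<comment> \<open>Each lower bound is at most each upper bound: in suitable positive powers of
      the two elements the exponents of \<open>a\<close> cancel, so their product lies in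
      \<open>B \<inter> C\<close>, where \<open>f\<close> is non-negative.\<close>
    have upper: "- f b / of_int p \<le> f c / of_int (- q)"
      if "b \<in> B" "b \<otimes> a [^] p \<in> C" "p > 0" "c \<in> B" "c \<otimes> a [^] q \<in> C" "q < 0" for b c p q
    proof -
      define m n where "m = nat (- q)" and "n = nat p"
      have mn: "int m = - q" "int n = p" using that by (auto simp: m_def n_def)
      note pow = submonoid_nat_pow_closed[OF C] and powB = subgroup_nat_pow_closed[OF B]
      have "(b \<otimes> a [^] p) [^] m \<otimes> (c \<otimes> a [^] q) [^] n \<in> C"
        using that pow C by (auto intro: submonoid.m_closed)
      also have "(b \<otimes> a [^] p) [^] m \<otimes> (c \<otimes> a [^] q) [^] n = (b [^] m \<otimes> c [^] n) \<otimes> a [^] (p * int m + q * int n)"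
        using that Bc a by (simp add: adjoin_nat_pow adjoin_mult)
      also have "\<dots> = b [^] m \<otimes> c [^] n"
        using mn that Bc a by simp
      finally have "0 \<le> f (b [^] m \<otimes> c [^] n)"
        using nonneg that powB subgroup.m_closed[OF B] by blast
      also have "\<dots> = real m * f b + real n * f c"
        using that powB by (simp add: additive_onD[OF f] additive_on_nat_pow[OF f B])
      also have "\<dots> = of_int (int m) * f b + of_int (int n) * f c" by simp
      also have "\<dots> = - of_int q * f b + of_int p * f c"
        unfolding mn by simp
      finally show ?thesis
        using that by (simp add: field_simps)
    qed
    \<comment> \<open>By \<open>upper\<close>, the supremum of the lower bounds respects all upper
      bounds too.\<close>
    define \<tau> where "\<tau> = Sup Lo"
    have ne: "Lo \<noteq> {}"
      using both(1-3) unfolding Lo_def by blast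
    have bdd: "bdd_above Lo"
    proof (rule bdd_aboveI)
      fix t assume "t \<in> Lo"
      then obtain b p where "t = - f b / of_int p" "b \<in> B" "p > 0" "b \<otimes> a [^] (p::int) \<in> C"
        unfolding Lo_def by blast
      then show "t \<le> f c / of_int (- q)"
        using upper[of b p c q] both(4-6) by simp
    qed
    have "0 \<le> f x + of_int r * \<tau>" if x: "x \<in> B" "x \<otimes> a [^] (r::int) \<in> C" for x r
    proof (cases r "0::int" rule: linorder_cases)
      case greater
      have "- f x / of_int r \<le> \<tau>"
        unfolding \<tau>_def by (rule cSup_upper[OF _ bdd]) (use x greater Lo_def in blast)
      then show ?thesis using greater by (simp add: field_simps)
    next
      case less
      have "\<tau> \<le> f x / of_int (- r)"
        unfolding \<tau>_def
      proof (rule cSup_least[OF ne])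
        fix t assume "t \<in> Lo"
        then obtain b p where "t = - f b / of_int p" "b \<in> B" "p > 0" "b \<otimes> a [^] (p::int) \<in> C"
          unfolding Lo_def by blast
        then show "t \<le> f x / of_int (- r)"
          using upper[of b p x r] x less by simp
      qed
      then show ?thesis using less by (simp add: field_simps)
    next
      case equal
      then show ?thesis using x nonneg Bc by auto
    qed
    then obtain f' where "additive_on G (adjoin B a) f'" "\<And>x. x \<in> adjoin B a \<inter> C \<Longrightarrow> 0 \<le> f' x"
      and f': "\<And>b p. b \<in> B \<Longrightarrow> f' (b \<otimes> a [^] (p::int)) = f b + of_int p * \<tau>"
      using extend_nonneg_additive[OF B a C f] by blast
    moreover have "f' x0 \<noteq> 0" "x0 \<in> adjoin B a"
      using f'[of x0 0] x0 Bc adjoin_superset[OF B a] by auto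
    ultimately show thesis using that by blast
  qed
qed

section \<open>Positive powers and finite transversals in finitely generated abelian groups\<close>

text \<open>If no positive power of \<open>g\<close> is in \<open>C\<close>, then
  \<open>g [^] p \<mapsto> - p\<close> is consistent and non-negative on the part of
  \<open>C\<close> in the cyclic group of \<open>g\<close>. Adjoining the generators one by one
  keeps a non-zero function that is non-negative on \<open>C\<close>, against
  \<open>van\<close>.\<close>

lemma positive_power_in_submonoid:
  assumes F: "finite F" "F \<subseteq> carrier G" "generate G F = carrier G"
    and C: "submonoid C G"
    and van: "unbiased G (carrier G) C"
    and g: "g \<in> carrier G"
  shows "\<exists>m::nat. m > 0 \<and> g [^] m \<in> C"
proof (rule ccontr)
  assume no: "\<not> ?thesis"
  have "\<exists>B f x. subgroup B G \<and> F \<subseteq> B \<and> additive_on G B f \<and> (\<forall>x\<in>B \<inter> C. 0 \<le> f x)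
      \<and> x \<in> B \<and> f x \<noteq> 0"
    using F(1,2)
  proof (induction F)
    case empty
    \<comment> \<open>The induction starts with the cyclic group of \<open>g\<close>, obtained by
      adjoining \<open>g\<close> to the trivial group.\<close>
    have triv: "subgroup {\<one>} G" by (rule triv_subgroup)
    have "additive_on G {\<one>} (\<lambda>_. 0)" by (simp add: additive_on_def)
    moreover have "(p::int) \<le> 0" if "\<one> \<otimes> g [^] p \<in> C" for p
    proof (rule ccontr)
      assume "\<not> p \<le> 0"
      then have "nat p > 0" "g [^] nat p = g [^] p"
        by (simp_all flip: int_pow_int)
      moreover have "g [^] p \<in> C" using that g by simp
      ultimately show False using no by metis
    qed
    ultimately obtain f where f: "additive_on G (adjoin {\<one>} g) f"
      "\<And>x. x \<in> adjoin {\<one>} g \<inter> C \<Longrightarrow> 0 \<le> f x"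
      "\<And>b p. b \<in> {\<one>} \<Longrightarrow> f (b \<otimes> g [^] (p::int)) = 0 + of_int p * (-1)"
      using extend_nonneg_additive[OF triv g C, of "\<lambda>_. 0" "-1"] by auto
    have "f g \<noteq> 0" using f(3)[of \<one> 1] g by simp
    then show ?case
      using f(1,2) subgroup_adjoin[OF triv g] adjoin_superset[OF triv g] by blast
  next
    case (insert a F)
    then obtain B f x where B: "subgroup B G" and "F \<subseteq> B" "additive_on G B f"
      "\<And>x. x \<in> B \<inter> C \<Longrightarrow> 0 \<le> f x" "x \<in> B" "f x \<noteq> 0" and a: "a \<in> carrier G"
      by auto
    then obtain f' y where "additive_on G (adjoin B a) f'" "\<And>x. x \<in> adjoin B a \<inter> C \<Longrightarrow> 0 \<le> f' x"
    "y \<in> adjoin B a" "f' y \<noteq> 0"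
      using adjoin_nonneg_additive_nonzero[OF B a C] by metis
    then show ?case
      using \<open>F \<subseteq> B\<close> subgroup_adjoin[OF B a] adjoin_superset[OF B a] by blast
  qed
  then obtain B f x where B: "subgroup B G" "F \<subseteq> B" "additive_on G B f"
      "\<forall>x\<in>B \<inter> C. 0 \<le> f x" "x \<in> B" "f x \<noteq> 0" by blast
  have "B = carrier G"
    using generate_subgroup_incl[OF B(2,1)] F(3) subgroup.subset[OF B(1)] by auto
  then show False
    using B unbiasedD[OF van, of f] submonoid.subset[OF C] by blast
qed

text \<open>The quotient by \<open>C\<close> is a finitely generated abelian torsion group, hence
  finite: for each generator only the exponents below the order of its class matter.\<close>

lemma finite_transversal_of_powers:
  assumes F: "finite F" "F \<subseteq> carrier G" "generate G F = carrier G"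
    and C: "subgroup C G"
    and pow: "\<And>g. g \<in> carrier G \<Longrightarrow> \<exists>m::nat. m > 0 \<and> g [^] m \<in> C"
  obtains T where "finite T" "T \<subseteq> carrier G" "\<And>g. g \<in> carrier G \<Longrightarrow> \<exists>c\<in>C. \<exists>t\<in>T. g = c \<otimes> t"
proof -
  have "\<exists>B T. subgroup B G \<and> F \<subseteq> B \<and> finite T \<and> T \<subseteq> carrier G \<and> (\<forall>g\<in>B. \<exists>c\<in>C. \<exists>t\<in>T. g = c \<otimes> t)"
    using F(1,2)
  proof (induction F)
    case empty
    have "\<exists>c\<in>C. \<one> = c \<otimes> \<one>"
      using subgroup.one_closed[OF C] by (intro bexI[of _ \<one>]) auto
    then show ?case
      by (intro exI[of _ "{\<one>}"]) (auto intro: triv_subgroup)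
  next
    case (insert a F)
    then obtain B T where B: "subgroup B G" "F \<subseteq> B" and T: "finite T" "T \<subseteq> carrier G"
      and BT: "\<And>g. g \<in> B \<Longrightarrow> \<exists>c\<in>C. \<exists>t\<in>T. g = c \<otimes> t" and a: "a \<in> carrier G"
      by auto
    obtain m :: nat where m: "m > 0" "a [^] m \<in> C" using pow[OF a] by blast
    define T' where "T' = (\<lambda>(t, i). t \<otimes> a [^] i) ` (T \<times> {..<m})"
    have "\<exists>c\<in>C. \<exists>t\<in>T'. g = c \<otimes> t" if g: "g \<in> adjoin B a" for g
    proof -
      obtain b p where b: "b \<in> B" "g = b \<otimes> a [^] (p::int)" using g by (rule adjoinE)
      obtain c t where ct: "c \<in> C" "t \<in> T" "b = c \<otimes> t" using BT[OF b(1)] by blast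
      \<comment> \<open>The multiple of \<open>m\<close> in the exponent is absorbed by
        \<open>C\<close>. Since \<open>mod\<close> is non-negative for negative \<open>p\<close>
        too, the remainder is a natural number below \<open>m\<close>.\<close>
      define q i where "q = p div int m" and "i = nat (p mod int m)"
      have p: "p = int m * q + int i" and i: "i < m"
        using m(1) by (auto simp: q_def i_def nat_less_iff)
      have cc: "c \<in> carrier G" "t \<in> carrier G"
        using ct T subgroup.mem_carrier[OF C] by auto
      have "a [^] p = (a [^] m) [^] q \<otimes> a [^] i"
        using a int_pow_pow[of a "int m" q] by (simp add: p int_pow_mult int_pow_int)
      then have "g = (c \<otimes> (a [^] m) [^] q) \<otimes> (t \<otimes> a [^] i)"
        using b ct cc a by (simp add: m_ac)
      moreover have "c \<otimes> (a [^] m) [^] q \<in> C"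
        using ct m C by (auto intro: subgroup.m_closed subgroup_int_pow_closed)
      ultimately show ?thesis
        using ct(2) i by (auto simp: T'_def)
    qed
    moreover have "finite T'" "T' \<subseteq> carrier G"
      using T a by (auto simp: T'_def)
    ultimately show ?case
      using subgroup_adjoin[OF B(1) a] adjoin_superset[OF B(1) a] B(2)
      by (intro exI[of _ "adjoin B a"] exI[of _ T']) auto
  qed
  then obtain B T where B: "subgroup B G" "F \<subseteq> B" and T: "finite T" "T \<subseteq> carrier G"
    "\<And>g. g \<in> B \<Longrightarrow> \<exists>c\<in>C. \<exists>t\<in>T. g = c \<otimes> t" by auto
  have "B = carrier G"
    using generate_subgroup_incl[OF B(2,1)] F(3) subgroup.subset[OF B(1)] by auto
  then show thesis using T that by blast
qed

end

section \<open>Commutators and the lower central series\<close>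

context group
begin

definition commutator :: "'a \<Rightarrow> 'a \<Rightarrow> 'a" where
  "commutator x g = x \<otimes> g \<otimes> inv x \<otimes> inv g"

lemma commutator_closed [simp]:
  "x \<in> carrier G \<Longrightarrow> g \<in> carrier G \<Longrightarrow> commutator x g \<in> carrier G"
  by (simp add: commutator_def)

lemma inv_cancel_left: "x \<in> carrier G \<Longrightarrow> y \<in> carrier G \<Longrightarrow> inv x \<otimes> (x \<otimes> y) = y"
  by (simp flip: m_assoc)

lemma cancel_inv_left: "x \<in> carrier G \<Longrightarrow> y \<in> carrier G \<Longrightarrow> x \<otimes> (inv x \<otimes> y) = y"
  by (simp flip: m_assoc)

text \<open>With the basic simp rules these reduce a group word to a right-nested form without
  cancelling neighbours, which proves the commutator identities below.\<close>

lemmas word_simps = m_assoc inv_mult_group inv_cancel_left cancel_inv_left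

lemma commutator_mult_left:
  assumes "x \<in> carrier G" "y \<in> carrier G" "g \<in> carrier G"
  shows "commutator (x \<otimes> y) g = (x \<otimes> commutator y g \<otimes> inv x) \<otimes> commutator x g"
  using assms by (simp add: commutator_def word_simps)

lemma commutator_mult_right:
  assumes "x \<in> carrier G" "g \<in> carrier G" "h \<in> carrier G"
  shows "commutator x (g \<otimes> h) = commutator x g \<otimes> (g \<otimes> commutator x h \<otimes> inv g)"
  using assms by (simp add: commutator_def word_simps)

lemma inv_commutator:
  assumes "x \<in> carrier G" "g \<in> carrier G"
  shows "inv (commutator x g) = commutator g x"
  using assms by (simp add: commutator_def word_simps)

lemma commutator_inv_right:
  assumes "x \<in> carrier G" "g \<in> carrier G"
  shows "commutator x (inv g) = inv g \<otimes> inv (commutator x g) \<otimes> g"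
  using assms by (simp add: commutator_def word_simps)

lemma conj_eq_commutator_mult:
  assumes "x \<in> carrier G" "g \<in> carrier G"
  shows "g \<otimes> x \<otimes> inv g = commutator g x \<otimes> x"
  using assms by (simp add: commutator_def word_simps)

lemma conj_commutator:
  assumes "x \<in> carrier G" "g \<in> carrier G" "h \<in> carrier G"
  shows "h \<otimes> commutator x g \<otimes> inv h = commutator (h \<otimes> x \<otimes> inv h) (h \<otimes> g \<otimes> inv h)"
  using assms by (simp add: commutator_def word_simps)

lemma normal_conj: "N \<lhd> G \<Longrightarrow> x \<in> N \<Longrightarrow> g \<in> carrier G \<Longrightarrow> g \<otimes> x \<otimes> inv g \<in> N"
  by (simp add: normal.inv_op_closed2)

lemma normal_conj': "N \<lhd> G \<Longrightarrow> x \<in> N \<Longrightarrow> g \<in> carrier G \<Longrightarrow> inv g \<otimes> x \<otimes> g \<in> N"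
  by (simp add: normal.inv_op_closed1)

lemma commutator_in_normal:
  assumes "N \<lhd> G" "x \<in> N" "g \<in> carrier G"
  shows "commutator x g \<in> N"
proof -
  note N = normal_imp_subgroup[OF assms(1)]
  have "x \<in> carrier G" using subgroup.mem_carrier[OF N assms(2)] .
  then have "commutator x g = x \<otimes> (g \<otimes> inv x \<otimes> inv g)"
    using assms(3) by (simp add: commutator_def m_assoc)
  then show ?thesis
    using normal_conj[OF assms(1) subgroup.m_inv_closed[OF N assms(2)] assms(3)]
      subgroup.m_closed[OF N assms(2)] by simp
qed

section \<open>Normality and finite generation of the lower central factors\<close>

lemma lower_central_Suc_eq:
  "lower_central G (Suc n) = generate G {commutator x g | x g. x \<in> lower_central G n \<and> g \<in> carrier G}"
  by (simp add: commutator_def)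

text \<open>Conjugation maps commutators to commutators, so the generating set of each term is
  stable under it.\<close>

lemma lower_central_normal: "lower_central G n \<lhd> G"
proof (induction n)
  case 0
  then show ?case using normal_self by simp
next
  case (Suc n)
  note sub = subgroup.mem_carrier[OF normal_imp_subgroup[OF Suc]]
  show ?case
    unfolding lower_central_Suc_eq
  proof (rule normal_generateI)
    show "{commutator x g | x g. x \<in> lower_central G n \<and> g \<in> carrier G} \<subseteq> carrier G"
      using sub by auto
    fix c h assume "c \<in> {commutator x g | x g. x \<in> lower_central G n \<and> g \<in> carrier G}" and h: "h \<in> carrier G"
    then obtain x g where c: "c = commutator x g" "x \<in> lower_central G n" "g \<in> carrier G" by blast
    then have "h \<otimes> c \<otimes> inv h = commutator (h \<otimes> x \<otimes> inv h) (h \<otimes> g \<otimes> inv h)"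
      using conj_commutator sub h by simp
    then show "h \<otimes> c \<otimes> inv h \<in> {commutator x g | x g. x \<in> lower_central G n \<and> g \<in> carrier G}"
      using normal_conj[OF Suc c(2) h] c(3) h by blast
  qed
qed

lemma lower_central_subgroup: "subgroup (lower_central G n) G"
  by (rule normal_imp_subgroup[OF lower_central_normal])

lemma lower_central_carrier: "x \<in> lower_central G n \<Longrightarrow> x \<in> carrier G"
  by (rule subgroup.mem_carrier[OF lower_central_subgroup])

lemma commutator_lower_central:
  "x \<in> lower_central G n \<Longrightarrow> g \<in> carrier G \<Longrightarrow> commutator x g \<in> lower_central G (Suc n)"
  unfolding lower_central_Suc_eq by (rule generate.incl) blast

lemma lower_central_Suc_subset: "lower_central G (Suc n) \<subseteq> lower_central G n"
  unfolding lower_central_Suc_eq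
proof (rule generate_subgroup_incl[OF _ lower_central_subgroup], rule subsetI)
  fix c assume "c \<in> {commutator x g | x g. x \<in> lower_central G n \<and> g \<in> carrier G}"
  then show "c \<in> lower_central G n"
    using commutator_in_normal[OF lower_central_normal] by blast
qed

text \<open>The set is the preimage of the centralizer of the class of \<open>x\<close> in
  \<open>G Mod N\<close>. It allows commutators to be tested on generators only.\<close>

lemma commutator_subgroup_right:
  assumes N: "N \<lhd> G" and x: "x \<in> carrier G"
  shows "subgroup {g \<in> carrier G. commutator x g \<in> N} G"
proof (rule subgroupI)
  note sN = normal_imp_subgroup[OF N]
  have "commutator x \<one> \<in> N"
    using x subgroup.one_closed[OF sN] by (simp add: commutator_def)
  then show "{g \<in> carrier G. commutator x g \<in> N} \<noteq> {}" by blast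
  show "inv g \<in> {g \<in> carrier G. commutator x g \<in> N}" if "g \<in> {g \<in> carrier G. commutator x g \<in> N}" for g
    using that x normal_conj'[OF N subgroup.m_inv_closed[OF sN]] by (simp add: commutator_inv_right)
  show "g \<otimes> h \<in> {g \<in> carrier G. commutator x g \<in> N}"
    if "g \<in> {g \<in> carrier G. commutator x g \<in> N}" "h \<in> {g \<in> carrier G. commutator x g \<in> N}" for g h
    using that x normal_conj[OF N] subgroup.m_closed[OF sN] by (simp add: commutator_mult_right)
qed auto

lemma commutator_subgroup_left:
  assumes N: "N \<lhd> G" and g: "g \<in> carrier G"
  shows "subgroup {x \<in> carrier G. commutator x g \<in> N} G"
proof -
  have "{x \<in> carrier G. commutator x g \<in> N} = {x \<in> carrier G. commutator g x \<in> N}"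
    using g inv_commutator subgroup.m_inv_closed[OF normal_imp_subgroup[OF N]]
    by (metis (no_types, lifting))
  then show ?thesis using commutator_subgroup_right[OF N g] by simp
qed

text \<open>Commutators of generators of one term, taken modulo the next, with generators of the
  group generate the next term modulo its successor.\<close>

lemma lower_central_finitely_generated_mod:
  assumes A: "finite A" "A \<subseteq> carrier G" "generate G A = carrier G"
  shows "\<exists>F. finite F \<and> F \<subseteq> lower_central G n
    \<and> generate G (F \<union> lower_central G (Suc n)) = lower_central G n"
proof (induction n)
  case 0
  have "carrier G \<subseteq> generate G (A \<union> lower_central G 1)"
    using mono_generate[of A "A \<union> lower_central G 1"] A(3) by auto
  moreover have "generate G (A \<union> lower_central G 1) \<subseteq> carrier G"
    using generate_incl[of "A \<union> lower_central G 1"] A(2) lower_central_carrier[of _ 1] by blast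
  ultimately show ?case
    using A by (intro exI[of _ A]) auto
next
  case (Suc n)
  then obtain F where F: "finite F" "F \<subseteq> lower_central G n"
    "generate G (F \<union> lower_central G (Suc n)) = lower_central G n" by blast
  define F' where "F' = (\<lambda>(x, a). commutator x a) ` (F \<times> A)"
  define M where "M = generate G (F' \<union> lower_central G (Suc (Suc n)))"
  have F': "finite F'" "F' \<subseteq> lower_central G (Suc n)"
    using F A by (auto simp: F'_def simp del: lower_central.simps intro!: commutator_lower_central)
  have M_sub: "M \<subseteq> lower_central G (Suc n)"
    unfolding M_def using F' lower_central_Suc_subset
    by (intro generate_subgroup_incl lower_central_subgroup) blast
  have N_sub: "lower_central G (Suc (Suc n)) \<subseteq> M"
    unfolding M_def by (auto simp del: lower_central.simps intro: generate.incl)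
  have sM: "subgroup M G"
    unfolding M_def using F' lower_central_carrier by (intro generate_is_subgroup) blast
  \<comment> \<open>\<open>M\<close> lies between two consecutive terms, so commutators of its
    elements with arbitrary ones fall into the smaller term and thus into \<open>M\<close>.\<close>
  have nM: "M \<lhd> G"
  proof (rule normal_invI[OF sM])
    fix g x assume g: "g \<in> carrier G" and x: "x \<in> M"
    then have xc: "x \<in> carrier G" using subgroup.mem_carrier[OF sM] by blast
    have "commutator x g \<in> M"
      using commutator_lower_central[of x "Suc n" g] x g M_sub N_sub by blast
    then have "commutator g x \<in> M"
      using inv_commutator[OF xc g] subgroup.m_inv_closed[OF sM] by metis
    then show "g \<otimes> x \<otimes> inv g \<in> M"
      using conj_eq_commutator_mult[OF xc g] subgroup.m_closed[OF sM _ x] by simp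
  qed
  \<comment> \<open>The second argument is freed from generators first, with \<open>x\<close> in
    \<open>F\<close> fixed; the first argument follows below.\<close>
  have gen: "commutator x g \<in> M" if x: "x \<in> F" and g: "g \<in> carrier G" for x g
  proof -
    have xc: "x \<in> carrier G" using x F lower_central_carrier by blast
    have "commutator x a \<in> M" if "a \<in> A" for a
      unfolding M_def using that x by (auto simp: F'_def simp del: lower_central.simps intro!: generate.incl)
    then have "generate G A \<subseteq> {g \<in> carrier G. commutator x g \<in> M}"
      using A(2) by (intro generate_subgroup_incl commutator_subgroup_right nM xc) auto
    then show ?thesis using g A(3) by auto
  qed
  have "commutator x g \<in> M" if x: "x \<in> lower_central G n" and g: "g \<in> carrier G" for x g
  proof -
    have "F \<union> lower_central G (Suc n) \<subseteq> {x \<in> carrier G. commutator x g \<in> M}"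
      using gen[OF _ g] commutator_lower_central[OF _ g, of _ "Suc n"] N_sub F(2) lower_central_carrier
      by blast
    then have "generate G (F \<union> lower_central G (Suc n)) \<subseteq> {x \<in> carrier G. commutator x g \<in> M}"
      by (intro generate_subgroup_incl commutator_subgroup_left nM g)
    then show ?thesis using x F(3) by auto
  qed
  then have "lower_central G (Suc n) \<subseteq> M"
    unfolding lower_central_Suc_eq by (intro generate_subgroup_incl sM) blast
  then have "M = lower_central G (Suc n)" using M_sub by blast
  then show ?case
    using F' by (intro exI[of _ F']) (simp add: M_def del: lower_central.simps)
qed

section \<open>Additive functions evaluated on commutators\<close>

text \<open>\<open>Y\<close>, \<open>Z\<close>, \<open>N\<close> model three consecutive terms of
  the lower central series. Composed with \<open>f\<close>, the commutator is a biadditive pairing.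
  It vanishes on pairs from \<open>L\<close>, and by \<open>pow\<close> every element has a positive
  power that agrees with an element of \<open>L\<close> modulo \<open>Z\<close>.\<close>

lemma nonneg_additive_commutator_eq_0:
  assumes Y: "Y \<lhd> G" and Z: "Z \<lhd> G" and N: "N \<lhd> G" and ZY: "Z \<subseteq> Y" and NZ: "N \<subseteq> Z"
    and YZ: "\<And>x g. x \<in> Y \<Longrightarrow> g \<in> carrier G \<Longrightarrow> commutator x g \<in> Z"
    and ZN: "\<And>x g. x \<in> Z \<Longrightarrow> g \<in> carrier G \<Longrightarrow> commutator x g \<in> N"
    and L: "submonoid L G" and NL: "N \<subseteq> L"
    and pow: "\<And>g. g \<in> carrier G \<Longrightarrow> \<exists>m::nat. \<exists>l\<in>L. \<exists>z\<in>Z. m > 0 \<and> g [^] m = l \<otimes> z"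
    and f: "additive_on G Z f" and nonneg: "\<And>z. z \<in> L \<inter> Z \<Longrightarrow> 0 \<le> f z"
    and x: "x \<in> Y" and g: "g \<in> carrier G"
  shows "f (commutator x g) = 0"
proof -
  note sY = normal_imp_subgroup[OF Y] and sZ = normal_imp_subgroup[OF Z]
    and sN = normal_imp_subgroup[OF N]
  note Yc = subgroup.mem_carrier[OF sY] and Zc = subgroup.mem_carrier[OF sZ]
    and Lc = submonoid.mem_carrier[OF L]
  note powL = submonoid_nat_pow_closed[OF L] and powY = subgroup_nat_pow_closed[OF sY]
  have fN: "f a = 0" if a: "a \<in> N" for a
  proof -
    have "0 \<le> f a" "0 \<le> f (inv a)"
      using nonneg a NL NZ subgroup.m_inv_closed[OF sN a] by auto
    then show ?thesis
      using additive_on_inv[OF f sZ, of a] a NZ by auto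
  qed
  \<comment> \<open>\<open>Z\<close> is central modulo \<open>N\<close>, and \<open>f\<close>
    vanishes on \<open>N\<close>.\<close>
  have f_conj: "f (a \<otimes> z \<otimes> inv a) = f z" if z: "z \<in> Z" and a: "a \<in> carrier G" for a z
  proof -
    have "commutator a z \<in> N"
      using ZN[OF z a] inv_commutator[OF Zc[OF z] a] subgroup.m_inv_closed[OF sN] by metis
    then show ?thesis
      using conj_eq_commutator_mult[OF Zc[OF z] a] additive_onD[OF f _ z] NZ fN by auto
  qed
  \<comment> \<open>By \<open>f_conj\<close> the conjugations in the commutator identities
    disappear, so \<open>B\<close> is additive in each argument; it vanishes if one of them is in
    \<open>Z\<close>.\<close>
  define B where "B a b = f (commutator a b)" for a b
  have B_left: "B (a \<otimes> b) c = B a c + B b c" if "a \<in> Y" "b \<in> Y" "c \<in> carrier G" for a b c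
    using that YZ Yc normal_conj[OF Z] f_conj
    by (simp add: B_def commutator_mult_left additive_onD[OF f])
  have B_right: "B a (b \<otimes> c) = B a b + B a c" if "a \<in> Y" "b \<in> carrier G" "c \<in> carrier G" for a b c
    using that YZ Yc normal_conj[OF Z] f_conj
    by (simp add: B_def commutator_mult_right additive_onD[OF f])
  have B_Z_left: "B z c = 0" if "z \<in> Z" "c \<in> carrier G" for z c
    using that ZN fN by (simp add: B_def)
  have B_Z_right: "B a z = 0" if "z \<in> Z" "a \<in> carrier G" for z a
    using fN ZN[OF that] inv_commutator[OF Zc[OF that(1)] that(2)] subgroup.m_inv_closed[OF sN]
    unfolding B_def by metis
  have B_one: "B \<one> c = 0" "B c \<one> = 0" if "c \<in> carrier G" for c
    using that B_Z_left B_Z_right subgroup.one_closed[OF sZ] by auto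
  have B_pow_left: "B (a [^] n) c = real n * B a c" if "a \<in> Y" "c \<in> carrier G" for a c and n :: nat
    by (induction n) (use that in \<open>simp_all add: B_one B_left powY algebra_simps\<close>)
  have B_pow_right: "B a (c [^] n) = real n * B a c" if "a \<in> Y" "c \<in> carrier G" for a c and n :: nat
    by (induction n) (use that in \<open>simp_all add: B_one B_right Yc algebra_simps\<close>)
  \<comment> \<open>If \<open>inv a [^] Suc k = l \<otimes> z\<close>, then
    \<open>a [^] k \<otimes> l\<close> is an inverse of \<open>a\<close> modulo \<open>Z\<close>
    inside \<open>L\<close>.\<close>
  have inverse: "\<exists>a'\<in>L. a \<otimes> a' \<in> Z" if a: "a \<in> L" for a
  proof -
    have ac: "a \<in> carrier G" using Lc[OF a] .
    obtain m :: nat and l z where m: "m > 0" "l \<in> L" "z \<in> Z" "inv a [^] m = l \<otimes> z"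
      using pow[of "inv a"] ac by blast
    then obtain k where k: "m = Suc k" using not0_implies_Suc by blast
    have lz: "l \<in> carrier G" "z \<in> carrier G" using m Lc Zc by auto
    have "l = inv a [^] m \<otimes> inv z" using m lz by (simp add: m_assoc)
    then have "a \<otimes> (a [^] k \<otimes> l) = (a [^] m \<otimes> inv (a [^] m)) \<otimes> inv z"
      using ac lz by (simp add: k nat_pow_Suc2 nat_pow_inv word_simps del: nat_pow_Suc)
    then have "a \<otimes> (a [^] k \<otimes> l) \<in> Z"
      using ac lz subgroup.m_inv_closed[OF sZ m(3)] by simp
    moreover have "a [^] k \<otimes> l \<in> L"
      using m powL a submonoid.m_closed[OF L] by blast
    ultimately show ?thesis by blast
  qed
  \<comment> \<open>The inner pair is central modulo \<open>N\<close>, so the product telescopes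
    under \<open>f\<close>, though \<open>a\<close> and \<open>a'\<close> need not commute.\<close>
  have pow_pair: "a [^] n \<otimes> a' [^] n \<in> Z \<and> f (a [^] n \<otimes> a' [^] n) = real n * f (a \<otimes> a')"
    if a: "a \<in> carrier G" "a' \<in> carrier G" "a \<otimes> a' \<in> Z" for a a' and n :: nat
  proof (induction n)
    case 0
    then show ?case
      using subgroup.one_closed[OF sZ] additive_on_one[OF f sZ] by simp
  next
    case (Suc n)
    have eq: "a [^] Suc n \<otimes> a' [^] Suc n = (a \<otimes> (a [^] n \<otimes> a' [^] n) \<otimes> inv a) \<otimes> (a \<otimes> a')"
      unfolding nat_pow_Suc2[OF a(1)] nat_pow_Suc[of a'] using a by (simp add: word_simps)
    have conj: "a \<otimes> (a [^] n \<otimes> a' [^] n) \<otimes> inv a \<in> Z"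
      using Suc normal_conj[OF Z] a by blast
    have "f (a [^] Suc n \<otimes> a' [^] Suc n) = real n * f (a \<otimes> a') + f (a \<otimes> a')"
      unfolding eq additive_onD[OF f conj a(3)] using Suc f_conj a(1) by simp
    moreover have "a [^] Suc n \<otimes> a' [^] Suc n \<in> Z"
      unfolding eq by (rule subgroup.m_closed[OF sZ conj a(3)])
    ultimately show ?case
      unfolding of_nat_Suc distrib_right by (intro conjI) simp_all
  qed
  \<comment> \<open>With \<open>a'\<close>, \<open>b'\<close> inverse to \<open>a\<close>, \<open>b\<close> modulo \<open>Z\<close>, the value of \<open>f\<close> at
    \<open>a\<^sup>n b\<^sup>n a'\<^sup>n b'\<^sup>n\<close> is quadratic in \<open>n\<close> with leading coefficient \<open>B a b\<close>.\<close>
  have B_nonneg: "0 \<le> B a b" if a: "a \<in> Y" "a \<in> L" and b: "b \<in> L" for a b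
  proof (rule ccontr)
    assume neg: "\<not> 0 \<le> B a b"
    obtain a' where a': "a' \<in> L" "a \<otimes> a' \<in> Z"
      using inverse[OF a(2)] by blast
    obtain b' where b': "b' \<in> L" "b \<otimes> b' \<in> Z"
      using inverse[OF b] by blast
    have car: "a \<in> carrier G" "b \<in> carrier G" "a' \<in> carrier G" "b' \<in> carrier G"
      using a a' b b' Lc by auto
    define s where "s = f (a \<otimes> a') + f (b \<otimes> b')"
    obtain n :: nat where n: "real n > s / (- B a b)" using reals_Archimedean2 by blast
    have "0 \<le> real n * (real n * B a b + s)" for n :: nat
    proof -
      let ?a = "a [^] n" and ?b = "b [^] n" and ?a' = "a' [^] n" and ?b' = "b' [^] n"
      have car': "?a \<in> carrier G" "?b \<in> carrier G" "?a' \<in> carrier G" "?b' \<in> carrier G"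
        using car by auto
      have pa: "?a \<otimes> ?a' \<in> Z" "f (?a \<otimes> ?a') = real n * f (a \<otimes> a')"
        and pb: "?b \<otimes> ?b' \<in> Z" "f (?b \<otimes> ?b') = real n * f (b \<otimes> b')"
        using pow_pair[OF car(1,3) a'(2)] pow_pair[OF car(2,4) b'(2)] by blast+
      have pab: "commutator ?a ?b \<in> Z" "f (commutator ?a ?b) = real n * (real n * B a b)"
        using YZ[OF powY[OF a(1)] car'(2)] B_pow_left[OF a(1) car'(2)] B_pow_right[OF a(1) car(2)]
        by (simp_all add: B_def)
      have pc: "?b \<otimes> (?a \<otimes> ?a') \<otimes> inv ?b \<in> Z"
        using normal_conj[OF Z pa(1) car'(2)] .
      have eq: "?a \<otimes> ?b \<otimes> ?a' \<otimes> ?b' =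
          commutator ?a ?b \<otimes> (?b \<otimes> (?a \<otimes> ?a') \<otimes> inv ?b) \<otimes> (?b \<otimes> ?b')"
        using car' by (simp add: commutator_def word_simps)
      have "?a \<otimes> ?b \<otimes> ?a' \<otimes> ?b' \<in> L"
        using powL a a' b b' by (intro submonoid.m_closed[OF L])
      moreover have "?a \<otimes> ?b \<otimes> ?a' \<otimes> ?b' \<in> Z"
        unfolding eq by (rule subgroup.m_closed[OF sZ subgroup.m_closed[OF sZ pab(1) pc] pb(1)])
      ultimately have "0 \<le> f (?a \<otimes> ?b \<otimes> ?a' \<otimes> ?b')" using nonneg by blast
      also have "\<dots> = f (commutator ?a ?b) + f (?a \<otimes> ?a') + f (?b \<otimes> ?b')"
        unfolding eq
        additive_onD[OF f subgroup.m_closed[OF sZ pab(1) pc] pb(1)] additive_onD[OF f pab(1) pc]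
          f_conj[OF pa(1) car'(2)] by simp
      finally show ?thesis
        unfolding pa(2) pb(2) pab(2) s_def by (simp add: algebra_simps)
    qed
    \<comment> \<open>The successor makes the common factor positive, so that it can be
      cancelled.\<close>
    from this[of "Suc n"] have "0 \<le> real (Suc n) * B a b + s"
      by (simp add: zero_le_mult_iff del: of_nat_Suc)
    moreover have "real n * (- B a b) > s" using n neg by (simp add: field_simps)
    ultimately show False using neg by (simp add: algebra_simps)
  qed
  \<comment> \<open>The inverse \<open>a'\<close> of \<open>a\<close> modulo \<open>Z\<close> also
    lies in \<open>Y\<close> and in \<open>L\<close>, and it changes the sign of the
    pairing.\<close>
  have B_zero: "B a b = 0" if a: "a \<in> Y" "a \<in> L" and b: "b \<in> L" for a b
  proof -
    obtain a' where a': "a' \<in> L" "a \<otimes> a' \<in> Z" using inverse a by blast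
    have "a' = inv a \<otimes> (a \<otimes> a')"
      using Yc a Lc a' by (simp add: inv_cancel_left)
    then have "a' \<in> Y"
      using a a' ZY subgroup.m_closed[OF sY] subgroup.m_inv_closed[OF sY] by (metis subsetD)
    then have "B a b + B a' b = 0" "0 \<le> B a' b"
      using B_left[of a a' b] B_Z_left[OF a'(2)] B_nonneg a a' b Lc by auto
    then show ?thesis using B_nonneg[OF a b] by linarith
  qed
  have xc: "x \<in> carrier G" using Yc[OF x] .
  \<comment> \<open>Positive powers of \<open>x\<close> and \<open>g\<close> are replaced by
    \<open>l\<close> and \<open>m\<close> from \<open>L\<close>; biadditivity gives
    \<open>k * j * B x g = B l m = 0\<close>.\<close>
  obtain k :: nat and l z where k: "k > 0" "l \<in> L" "z \<in> Z" "x [^] k = l \<otimes> z"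
    using pow[OF xc] by blast
  obtain j :: nat and m w where j: "j > 0" "m \<in> L" "w \<in> Z" "g [^] j = m \<otimes> w"
    using pow[OF g] by blast
  have "l = x [^] k \<otimes> inv z"
    using k Lc Zc by (simp add: m_assoc)
  then have lY: "l \<in> Y"
    using powY[OF x] k(3) ZY subgroup.m_closed[OF sY] subgroup.m_inv_closed[OF sY] by auto
  have "real k * B x g = B l g"
    using B_pow_left[OF x g, of k] B_left[OF lY _ g, of z] B_Z_left[OF k(3) g] k ZY by auto
  moreover have "real j * B l g = 0"
    using B_pow_right[OF lY g, of j] B_right[OF lY, of m w] B_Z_right[OF j(3)] B_zero[OF lY k(2) j(2)]
      j Lc Zc Yc lY by simp
  ultimately show ?thesis using k j by (simp add: B_def)
qed

section \<open>Submonoids containing positive powers, and passage to abelian sections\<close>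

lemma subgroup_imp_submonoid: "subgroup H G \<Longrightarrow> submonoid H G"
  by (simp add: submonoid_def subgroup_def)

text \<open>If \<open>inv x [^] Suc k\<close> is in \<open>C\<close>, then multiplying it by
  \<open>x [^] k\<close> exhibits \<open>inv x\<close> as an element of \<open>C\<close>.\<close>

lemma submonoid_positive_powers_subgroup:
  assumes A: "subgroup A G" and C: "submonoid C G" "C \<subseteq> A"
    and pow: "\<And>g. g \<in> A \<Longrightarrow> \<exists>m::nat. m > 0 \<and> g [^] m \<in> C"
  shows "subgroup C G"
proof (rule subgroupI)
  show "C \<subseteq> carrier G" "C \<noteq> {}"
    using C submonoid.subset submonoid.one_closed by blast+
  show "x \<otimes> y \<in> C" if "x \<in> C" "y \<in> C" for x y
    using that submonoid.m_closed[OF C(1)] by blast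
  show "inv x \<in> C" if x: "x \<in> C" for x
  proof -
    have xc: "x \<in> carrier G" using x C subgroup.subset[OF A] by blast
    obtain m :: nat where m: "m > 0" "inv x [^] m \<in> C"
      using pow[of "inv x"] subgroup.m_inv_closed[OF A] x C(2) by blast
    then obtain k where k: "m = Suc k" using not0_implies_Suc by blast
    have "inv x [^] m \<otimes> x [^] k = inv x \<otimes> (inv x [^] k \<otimes> x [^] k)"
      unfolding k nat_pow_Suc2[OF inv_closed[OF xc]] using xc by (simp add: m_assoc)
    also have "\<dots> = inv x"
      using xc by (simp add: nat_pow_inv)
    finally have "inv x [^] m \<otimes> x [^] k = inv x" .
    then show ?thesis
      using submonoid.m_closed[OF C(1) m(2) submonoid_nat_pow_closed[OF C(1) x, of k]] by simp
  qed
qed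

lemma comm_group_Mod:
  assumes N: "N \<lhd> G"
    and comm: "\<And>x y. x \<in> carrier G \<Longrightarrow> y \<in> carrier G \<Longrightarrow> commutator x y \<in> N"
  shows "comm_group (G Mod N)"
proof (rule group.group_comm_groupI)
  show "group (G Mod N)" using normal.factorgroup_is_group[OF N] .
  fix X Y assume "X \<in> carrier (G Mod N)" "Y \<in> carrier (G Mod N)"
  then obtain x y where xy: "X = N #> x" "x \<in> carrier G" "Y = N #> y" "y \<in> carrier G"
    by (auto simp: carrier_FactGroup)
  have "x \<otimes> y = commutator x y \<otimes> (y \<otimes> x)"
    using xy by (simp add: commutator_def word_simps)
  then have "x \<otimes> y \<in> N #> (y \<otimes> x)"
    using rcosI[OF comm[OF xy(2,4)], of "y \<otimes> x"] xy normal_imp_subgroup[OF N] subgroup.subset by auto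
  then have "N #> (y \<otimes> x) = N #> (x \<otimes> y)"
    using repr_independence xy normal_imp_subgroup[OF N] by auto
  then show "X \<otimes>\<^bsub>G Mod N\<^esub> Y = Y \<otimes>\<^bsub>G Mod N\<^esub> X"
    using normal.rcos_sum[OF N] xy by simp
qed

text \<open>The results for abelian groups are pulled back from \<open>G Mod N\<close>. As
  \<open>N \<subseteq> C\<close>, the submonoid \<open>C\<close> is a union of cosets of
  \<open>N\<close>, so membership can be tested on images.\<close>

lemma
  assumes N: "N \<lhd> G"
    and comm: "\<And>x y. x \<in> carrier G \<Longrightarrow> y \<in> carrier G \<Longrightarrow> commutator x y \<in> N"
    and F: "finite F" "F \<subseteq> carrier G" "generate G (F \<union> N) = carrier G"
    and C: "submonoid C G" "N \<subseteq> C"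
    and van: "unbiased G (carrier G) C"
  shows positive_power_in_submonoid_mod: "g \<in> carrier G \<Longrightarrow> \<exists>m::nat. m > 0 \<and> g [^] m \<in> C"
    and finite_transversal_mod: "\<exists>T. finite T \<and> T \<subseteq> carrier G \<and> (\<forall>g\<in>carrier G. \<exists>c\<in>C. \<exists>t\<in>T. g = c \<otimes> t)"
proof -
  let ?K = "G Mod N"
  define h where "h x = N #> x" for x
  have sN: "subgroup N G" using normal_imp_subgroup[OF N] .
  interpret K: comm_group ?K using comm_group_Mod[OF N comm] .
  have hom: "h \<in> hom G ?K"
    using normal.r_coset_hom_Mod[OF N] by (simp add: h_def[abs_def])
  interpret h: group_hom G ?K h
    using hom by unfold_locales (simp add: group_hom_axioms_def)
  have surj: "carrier ?K = h ` carrier G"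
    by (simp add: carrier_FactGroup h_def)
  have h_one: "h x = \<one>\<^bsub>?K\<^esub>" if "x \<in> N" for x
    using coset_join2[OF _ sN that] that subgroup.subset[OF sN] by (auto simp: h_def)
  have h_pow: "h (x [^] (m::nat)) = h x [^]\<^bsub>?K\<^esub> m" if "x \<in> carrier G" for x m
    using h.hom_nat_pow[OF that] by simp
  have h_C: "x \<in> C" if x: "x \<in> carrier G" "h x \<in> h ` C" for x
  proof -
    obtain c where c: "c \<in> C" "h x = h c" using x(2) by blast
    then have cc: "c \<in> carrier G" using submonoid.subset[OF C(1)] by blast
    have "x \<in> N #> c"
      using repr_independenceD[OF sN x(1), of c] c(2) by (simp add: h_def)
    then show ?thesis
      using c C submonoid.m_closed[OF C(1)] by (auto simp: r_coset_def)
  qed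
  have hC: "submonoid (h ` C) ?K"
  proof (unfold_locales)
    show "h ` C \<subseteq> carrier ?K" using submonoid.subset[OF C(1)] surj by blast
    show "\<one>\<^bsub>?K\<^esub> \<in> h ` C" using h.hom_one submonoid.one_closed[OF C(1)] by (metis image_eqI)
    fix x y assume "x \<in> h ` C" "y \<in> h ` C"
    then obtain a b where "x = h a" "y = h b" "a \<in> C" "b \<in> C" by blast
    then show "x \<otimes>\<^bsub>?K\<^esub> y \<in> h ` C"
      using submonoid.m_closed[OF C(1), of a b] submonoid.subset[OF C(1)] h.hom_mult[of a b]
      by (metis image_eqI subsetD)
  qed
  have NC: "F \<union> N \<subseteq> carrier G" using F(2) subgroup.subset[OF sN] by blast
  have "generate ?K (h ` (F \<union> N)) = carrier ?K"
    using h.generate_img[OF NC] F(3) surj by simp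
  moreover have "h ` (F \<union> N) = insert \<one>\<^bsub>?K\<^esub> (h ` F)"
    using h_one subgroup.one_closed[OF sN] by (auto simp: image_Un)
  ultimately have gen: "generate ?K (insert \<one>\<^bsub>?K\<^esub> (h ` F)) = carrier ?K" by simp
  have fin: "finite (insert \<one>\<^bsub>?K\<^esub> (h ` F))" "insert \<one>\<^bsub>?K\<^esub> (h ` F) \<subseteq> carrier ?K"
    using F(1,2) surj K.one_closed by auto
  have unb: "unbiased ?K (carrier ?K) (h ` C)"
  proof (rule unbiasedI)
    fix f :: "'a set \<Rightarrow> real" and X
    assume f: "additive_on ?K (carrier ?K) f" "\<And>x. x \<in> h ` C \<Longrightarrow> 0 \<le> f x" and X: "X \<in> carrier ?K"
    have "additive_on G (carrier G) (f \<circ> h)"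
      using f(1) h.hom_mult surj by (auto simp: additive_on_def)
    then have "(f \<circ> h) x = 0" if "x \<in> carrier G" for x
      using unbiasedD[OF van, of "f \<circ> h"] f(2) that by auto
    then show "f X = 0" using X surj by auto
  qed
  note powK = K.positive_power_in_submonoid[OF fin gen hC unb]
  show pow: "\<exists>m::nat. m > 0 \<and> g [^] m \<in> C" if g: "g \<in> carrier G" for g
    using powK[of "h g"] h_C[of "g [^] (_::nat)"] h_pow[OF g] g surj
    by (metis imageI nat_pow_closed)
  have "subgroup (h ` C) ?K"
    using K.submonoid_positive_powers_subgroup[OF K.subgroup_self hC submonoid.subset[OF hC]] powK
    by blast
  then obtain T where T: "finite T" "T \<subseteq> carrier ?K"
    "\<And>X. X \<in> carrier ?K \<Longrightarrow> \<exists>c\<in>h ` C. \<exists>t\<in>T. X = c \<otimes>\<^bsub>?K\<^esub> t"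
    using K.finite_transversal_of_powers[OF fin gen _ powK] by blast
  have "\<exists>T'\<subseteq>carrier G. finite T' \<and> T = h ` T'"
    using T(1,2) surj by (metis finite_subset_image)
  then obtain T' where T': "T' \<subseteq> carrier G" "finite T'" "T = h ` T'" by blast
  have C_sub: "subgroup C G"
    using submonoid_positive_powers_subgroup[OF subgroup_self C(1) submonoid.subset[OF C(1)]] pow by blast
  have "\<exists>c\<in>C. \<exists>t\<in>T'. g = c \<otimes> t" if g: "g \<in> carrier G" for g
  proof -
    obtain c t where ct: "c \<in> C" "t \<in> T'" "h g = h c \<otimes>\<^bsub>?K\<^esub> h t"
      using T(3)[of "h g"] g surj T'(3) by auto
    have cc: "c \<in> carrier G" "t \<in> carrier G"
      using ct T' subgroup.subset[OF C_sub] by auto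
    have "h c = h g \<otimes>\<^bsub>?K\<^esub> inv\<^bsub>?K\<^esub> h t"
      using K.inv_solve_right[of "h c" "h g" "h t"] ct(3) cc g h.hom_closed by blast
    then have "h (g \<otimes> inv t) = h c"
      using cc g h.hom_mult[of g "inv t"] h.hom_inv[of t] by simp
    then have "g \<otimes> inv t \<in> C" using h_C[of "g \<otimes> inv t"] ct cc g by auto
    moreover have "g = (g \<otimes> inv t) \<otimes> t" using cc g by (simp add: m_assoc)
    ultimately show ?thesis using ct by blast
  qed
  then show "\<exists>T. finite T \<and> T \<subseteq> carrier G \<and> (\<forall>g\<in>carrier G. \<exists>c\<in>C. \<exists>t\<in>T. g = c \<otimes> t)"
    using T' by blast
qed

text \<open>This is the previous result for \<open>A\<close> as a group of its own, in the form that
  suits a factor \<open>A / N\<close> of the lower central series.\<close>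

lemma
  assumes A: "subgroup A G" and N: "N \<lhd> G" "N \<subseteq> A"
    and comm: "\<And>x y. x \<in> A \<Longrightarrow> y \<in> A \<Longrightarrow> commutator x y \<in> N"
    and F: "finite F" "F \<subseteq> A" "generate G (F \<union> N) = A"
    and C: "submonoid C G" "C \<subseteq> A" "N \<subseteq> C"
    and van: "unbiased G A C"
  shows positive_power_in_submonoid_section: "g \<in> A \<Longrightarrow> \<exists>m::nat. m > 0 \<and> g [^] m \<in> C"
    and finite_transversal_section: "\<exists>T. finite T \<and> T \<subseteq> A \<and> (\<forall>g\<in>A. \<exists>c\<in>C. \<exists>t\<in>T. g = c \<otimes> t)"
proof -
  let ?H = "G\<lparr>carrier := A\<rparr>"
  interpret H: group ?H using subgroup_imp_group[OF A] .
  have N': "N \<lhd> ?H" using normal_restrict_supergroup[OF A N] .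
  have comm': "H.commutator x y \<in> N" if "x \<in> carrier ?H" "y \<in> carrier ?H" for x y
    using comm that m_inv_consistent[OF A] by (simp add: commutator_def H.commutator_def)
  have gen: "generate ?H (F \<union> N) = carrier ?H"
    using generate_consistent[of "F \<union> N" A] A F N by simp
  have C': "submonoid C ?H"
    using C submonoid.m_closed[OF C(1)] submonoid.one_closed[OF C(1)] by unfold_locales auto
  have van': "unbiased ?H (carrier ?H) C"
    using van by (simp add: unbiased_def additive_on_def)
  have F': "F \<subseteq> carrier ?H" using F by simp
  show "\<exists>m::nat. m > 0 \<and> g [^] m \<in> C" if "g \<in> A"
    using H.positive_power_in_submonoid_mod[OF N' comm' F(1) F' gen C' C(3) van'] that nat_pow_consistent
    by simp
  show "\<exists>T. finite T \<and> T \<subseteq> A \<and> (\<forall>g\<in>A. \<exists>c\<in>C. \<exists>t\<in>T. g = c \<otimes> t)"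
    using H.finite_transversal_mod[OF N' comm' F(1) F' gen C' C(3) van'] by simp
qed

section \<open>Induction along the lower central series\<close>

lemma set_mult_submonoid:
  assumes L: "submonoid L G" and N: "N \<lhd> G"
  shows "submonoid (L <#> N) G"
proof
  note sN = normal_imp_subgroup[OF N]
  note Lc = submonoid.mem_carrier[OF L] and Nc = subgroup.mem_carrier[OF sN]
  show "L <#> N \<subseteq> carrier G"
    using Lc Nc by (auto simp: set_mult_def)
  show "\<one> \<in> L <#> N"
    using submonoid.one_closed[OF L] subgroup.one_closed[OF sN] by (force simp: set_mult_def)
  fix x y assume "x \<in> L <#> N" "y \<in> L <#> N"
  then obtain a n b m where xy: "x = a \<otimes> n" "y = b \<otimes> m" "a \<in> L" "b \<in> L" "n \<in> N" "m \<in> N"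
    by (auto simp: set_mult_def)
  have "x \<otimes> y = (a \<otimes> b) \<otimes> ((inv b \<otimes> n \<otimes> b) \<otimes> m)"
    using xy Lc Nc by (simp add: word_simps)
  moreover have "(inv b \<otimes> n \<otimes> b) \<otimes> m \<in> N"
    using normal_conj'[OF N] xy Lc subgroup.m_closed[OF sN] by blast
  ultimately show "x \<otimes> y \<in> L <#> N"
    using xy submonoid.m_closed[OF L] by (auto simp: set_mult_def)
qed

lemma subset_set_mult:
  assumes "submonoid L G" "N \<lhd> G"
  shows "L \<subseteq> L <#> N" "N \<subseteq> L <#> N"
proof -
  note sN = normal_imp_subgroup[OF assms(2)]
  show "L \<subseteq> L <#> N"
    using submonoid.mem_carrier[OF assms(1)] subgroup.one_closed[OF sN]
    by (force simp: set_mult_def)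
  show "N \<subseteq> L <#> N"
    using subgroup.mem_carrier[OF sN] submonoid.one_closed[OF assms(1)]
    by (force simp: set_mult_def)
qed

text \<open>Modulo \<open>N\<close> the elements \<open>l\<close> and \<open>z\<close> commute;
  \<open>u\<close> collects the resulting error.\<close>

lemma pow_mult_mod_central:
  assumes Z: "Z \<lhd> G" and N: "N \<lhd> G"
    and ZN: "\<And>x g. x \<in> Z \<Longrightarrow> g \<in> carrier G \<Longrightarrow> commutator x g \<in> N"
    and l: "l \<in> carrier G" and z: "z \<in> Z"
  obtains u where "u \<in> N" "(l \<otimes> z) [^] (k::nat) = l [^] k \<otimes> z [^] k \<otimes> u"
proof -
  note sN = normal_imp_subgroup[OF N] and sZ = normal_imp_subgroup[OF Z]
  have zc: "z \<in> carrier G" using subgroup.mem_carrier[OF sZ z] .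
  have "\<exists>u\<in>N. (l \<otimes> z) [^] k = l [^] k \<otimes> z [^] k \<otimes> u"
  proof (induction k)
    case 0
    then show ?case using subgroup.one_closed[OF sN] by force
  next
    case (Suc k)
    then obtain u where u: "u \<in> N" "(l \<otimes> z) [^] k = l [^] k \<otimes> z [^] k \<otimes> u" by blast
    have uc: "u \<in> carrier G" using subgroup.mem_carrier[OF sN u(1)] .
    have zk: "z [^] k \<in> Z" using subgroup_nat_pow_closed[OF sZ z] .
    have zl: "z [^] Suc k = z \<otimes> z [^] k" using nat_pow_Suc2[OF zc] .
    \<comment> \<open>The correction term in
      \<open>z [^] k \<otimes> l = l \<otimes> z [^] k \<otimes> c\<close>.\<close>
    define c where "c = commutator (inv (z [^] k)) (inv l)"
    have c: "c \<in> N" unfolding c_def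
      using ZN subgroup.m_inv_closed[OF sZ zk] l by blast
    have cc: "c \<in> carrier G" using subgroup.mem_carrier[OF sN c] .
    have zlc: "z [^] k \<otimes> l = l \<otimes> z [^] k \<otimes> c"
      using l zc by (simp add: c_def commutator_def word_simps)
    have "(l \<otimes> z) [^] Suc k = l [^] k \<otimes> (z [^] k \<otimes> l) \<otimes> (inv l \<otimes> u \<otimes> l) \<otimes> z"
      using u l zc uc by (simp add: word_simps)
    also have "\<dots> = l [^] Suc k \<otimes> z [^] Suc k \<otimes> (inv z \<otimes> (c \<otimes> (inv l \<otimes> u \<otimes> l)) \<otimes> z)"
      unfolding zlc using l zc uc cc by (simp add: word_simps)
    finally have "(l \<otimes> z) [^] Suc k = l [^] Suc k \<otimes> z [^] Suc k \<otimes> (inv z \<otimes> (c \<otimes> (inv l \<otimes> u \<otimes> l)) \<otimes> z)" .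
    moreover have "inv z \<otimes> (c \<otimes> (inv l \<otimes> u \<otimes> l)) \<otimes> z \<in> N"
      by (intro normal_conj'[OF N] subgroup.m_closed[OF sN] c u(1) l zc)
    ultimately show ?case by blast
  qed
  then show thesis using that by blast
qed

lemma additive_on_generate_eq_0:
  assumes f: "additive_on G (generate G X) f" and X: "X \<subseteq> carrier G"
    and zero: "\<And>x. x \<in> X \<Longrightarrow> f x = 0" and x: "x \<in> generate G X"
  shows "f x = 0"
proof -
  note sg = generate_is_subgroup[OF X]
  show ?thesis
    using x
  proof (induction rule: generate.induct)
    case one
    show ?case by (rule additive_on_one[OF f sg])
  next
    case (incl h)
    then show ?case by (rule zero)
  next
    case (inv h)
    then show ?case using additive_on_inv[OF f sg generate.incl] zero by simp
  next
    case (eng h1 h2)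
    then show ?case using additive_onD[OF f] by simp
  qed
qed

text \<open>Together the two conclusions make \<open>L <#> lower_central G n\<close> a subgroup of
  finite index. The positive powers feed the commutator argument at the next stage; the transversals
  multiply up to the final finite index.\<close>

lemma submonoid_mod_lower_central:
  assumes A: "finite A" "A \<subseteq> carrier G" "generate G A = carrier G"
    and L: "submonoid L G"
    and van: "unbiased G (carrier G) L"
  shows "(\<forall>g\<in>carrier G. \<exists>m::nat. m > 0 \<and> g [^] m \<in> L <#> lower_central G n) \<and>
    (\<exists>T. finite T \<and> T \<subseteq> carrier G \<and>
      (\<forall>g\<in>carrier G. \<exists>l\<in>L <#> lower_central G n. \<exists>t\<in>T. g = l \<otimes> t))"
proof (induction n)
  case 0
  have "carrier G \<subseteq> L <#> carrier G"
    using subset_set_mult(2)[OF L normal_self] .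
  then have "g [^] (1::nat) \<in> L <#> carrier G" "\<exists>l\<in>L <#> carrier G. \<exists>t\<in>{\<one>}. g = l \<otimes> t"
    if "g \<in> carrier G" for g
    using that by (auto intro!: bexI[of _ g])
  then have "\<forall>g\<in>carrier G. \<exists>m::nat. m > 0 \<and> g [^] m \<in> L <#> carrier G"
    "finite {\<one>} \<and> {\<one>} \<subseteq> carrier G \<and> (\<forall>g\<in>carrier G. \<exists>l\<in>L <#> carrier G. \<exists>t\<in>{\<one>}. g = l \<otimes> t)"
    using zero_less_one by blast+
  then show ?case
    unfolding lower_central.simps(1) by blast
next
  case (Suc n)
  let ?Z = "lower_central G n" and ?N = "lower_central G (Suc n)"
  have IH: "\<forall>g\<in>carrier G. \<exists>m::nat. m > 0 \<and> g [^] m \<in> L <#> ?Z"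
    "\<exists>T. finite T \<and> T \<subseteq> carrier G \<and> (\<forall>g\<in>carrier G. \<exists>l\<in>L <#> ?Z. \<exists>t\<in>T. g = l \<otimes> t)"
    using Suc by (rule conjunct1, rule conjunct2)
  define L' where "L' = L <#> ?N"
  define C where "C = L' \<inter> ?Z"
  note nZ = lower_central_normal[of n] and nN = lower_central_normal[of "Suc n"]
  note sZ = lower_central_subgroup[of n] and sN = lower_central_subgroup[of "Suc n"]
  note NZ = lower_central_Suc_subset[of n]
  have L': "submonoid L' G" "L \<subseteq> L'" "?N \<subseteq> L'"
    unfolding L'_def using set_mult_submonoid[OF L nN] subset_set_mult[OF L nN] by auto
  have C: "submonoid C G"
    using L'(1) subgroup_imp_submonoid[OF sZ] unfolding C_def submonoid_def by blast
  obtain F where F: "finite F" "F \<subseteq> ?Z" "generate G (F \<union> ?N) = ?Z"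
    using lower_central_finitely_generated_mod[OF A] by blast
  have comm: "commutator x y \<in> ?N" if "x \<in> ?Z" "y \<in> ?Z" for x y
    using commutator_lower_central that lower_central_carrier by blast
  \<comment> \<open>For \<open>n = 0\<close> this is the hypothesis \<open>van\<close>. Otherwise
    \<open>?Z\<close> is generated by commutators, on which \<open>f\<close> vanishes by the pairing
    argument.\<close>
  have "f x = 0" if f: "additive_on G ?Z f" "\<And>x. x \<in> C \<Longrightarrow> 0 \<le> f x" and x: "x \<in> ?Z" for f x
  proof (cases n)
    case 0
    then show ?thesis
      using unbiasedD[OF van, of f x] f x L'(2) submonoid.mem_carrier[OF L] by (auto simp: C_def)
  next
    case (Suc k)
    let ?X = "{commutator x g | x g. x \<in> lower_central G k \<and> g \<in> carrier G}"
    have Zeq: "?Z = generate G ?X" unfolding Suc by (rule lower_central_Suc_eq)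
    have pow: "\<exists>m::nat. \<exists>l\<in>L'. \<exists>z\<in>?Z. m > 0 \<and> g [^] m = l \<otimes> z" if g: "g \<in> carrier G" for g
    proof -
      obtain m :: nat where m: "m > 0" "g [^] m \<in> L <#> ?Z" using IH(1) g by blast
      then obtain l z where "l \<in> L" "z \<in> ?Z" "g [^] m = l \<otimes> z" by (auto simp: set_mult_def)
      then show ?thesis using m(1) L'(2) by blast
    qed
    have "f (commutator y g) = 0" if "y \<in> lower_central G k" "g \<in> carrier G" for y g
    proof (rule nonneg_additive_commutator_eq_0[OF lower_central_normal[of k] nZ nN _ NZ _ _ L'(1,3) pow f(1)])
      show "?Z \<subseteq> lower_central G k" unfolding Suc by (rule lower_central_Suc_subset)
      show "commutator x g \<in> ?Z" if "x \<in> lower_central G k" "g \<in> carrier G" for x g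
        unfolding Suc using that by (rule commutator_lower_central)
      show "commutator x g \<in> ?N" if "x \<in> ?Z" "g \<in> carrier G" for x g
        using that by (rule commutator_lower_central)
      show "0 \<le> f z" if "z \<in> L' \<inter> ?Z" for z
        using f(2) that by (simp add: C_def)
    qed (use that in auto)
    moreover have "?X \<subseteq> carrier G" using lower_central_carrier by auto
    ultimately show ?thesis
      using additive_on_generate_eq_0[of ?X f x] f(1) x unfolding Zeq by blast
  qed
  then have vanC: "unbiased G ?Z C" by (rule unbiasedI)
  have NC: "?N \<subseteq> C" "C \<subseteq> ?Z" using L'(3) NZ by (auto simp: C_def simp del: lower_central.simps)
  have powC: "\<exists>m::nat. m > 0 \<and> z [^] m \<in> C" if "z \<in> ?Z" for z
    using positive_power_in_submonoid_section[OF sZ nN NZ comm F C NC(2,1) vanC that] .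
  obtain T' where T': "finite T'" "T' \<subseteq> ?Z" "\<And>z. z \<in> ?Z \<Longrightarrow> \<exists>c\<in>C. \<exists>t\<in>T'. z = c \<otimes> t"
    using finite_transversal_section[OF sZ nN NZ comm F C NC(2,1) vanC] by blast
  obtain T where T: "finite T" "T \<subseteq> carrier G"
    "\<And>g. g \<in> carrier G \<Longrightarrow> \<exists>l\<in>L <#> ?Z. \<exists>t\<in>T. g = l \<otimes> t"
    using IH(2) by blast
  note Lc = submonoid.mem_carrier[OF L] and Zc = lower_central_carrier
  have "\<exists>m::nat. m > 0 \<and> g [^] m \<in> L'" if g: "g \<in> carrier G" for g
  proof -
    obtain m :: nat where m: "m > 0" "g [^] m \<in> L <#> ?Z" using IH(1) g by blast
    then obtain l z where lz: "l \<in> L" "z \<in> ?Z" "g [^] m = l \<otimes> z" by (auto simp: set_mult_def)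
    obtain k :: nat where k: "k > 0" "z [^] k \<in> C" using powC[OF lz(2)] by blast
    \<comment> \<open>Thus \<open>g [^] (m * k)\<close> is a product of three factors from
      \<open>L'\<close>.\<close>
    obtain u where u: "u \<in> ?N" "(l \<otimes> z) [^] k = l [^] k \<otimes> z [^] k \<otimes> u"
      using pow_mult_mod_central[OF nZ nN commutator_lower_central Lc[OF lz(1)] lz(2)] by blast
    have "l [^] k \<in> L'" using submonoid_nat_pow_closed[OF L'(1)] lz(1) L'(2) by blast
    then have "l [^] k \<otimes> z [^] k \<otimes> u \<in> L'"
      using k u(1) L'(3) by (intro submonoid.m_closed[OF L'(1)]) (auto simp: C_def simp del: lower_central.simps)
    then have "g [^] (m * k) \<in> L'"
      using u(2) lz(3) nat_pow_pow[OF g, of m k] by simp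
    then show ?thesis using m k by (metis nat_0_less_mult_iff)
  qed
  \<comment> \<open>Representatives of \<open>?Z\<close> over \<open>C\<close> are combined with
    those of the previous stage: \<open>g = l \<otimes> z \<otimes> t = (l \<otimes> c) \<otimes> (s
    \<otimes> t)\<close>.\<close>
  moreover have "\<exists>l\<in>L'. \<exists>t\<in>T' <#> T. g = l \<otimes> t" if g: "g \<in> carrier G" for g
  proof -
    obtain x t where x: "x \<in> L <#> ?Z" "t \<in> T" "g = x \<otimes> t" using T(3)[OF g] by blast
    then obtain l z where lz: "l \<in> L" "z \<in> ?Z" "x = l \<otimes> z" by (auto simp: set_mult_def)
    obtain c s where cs: "c \<in> C" "s \<in> T'" "z = c \<otimes> s" using T'(3)[OF lz(2)] by blast
    have car: "l \<in> carrier G" "c \<in> carrier G" "s \<in> carrier G" "t \<in> carrier G"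
      using lz cs x T T' Lc Zc submonoid.mem_carrier[OF C] by auto
    have "g = (l \<otimes> c) \<otimes> (s \<otimes> t)" using x lz cs car by (simp add: m_assoc)
    moreover have "l \<otimes> c \<in> L'"
      using lz(1) L'(2) cs(1) by (intro submonoid.m_closed[OF L'(1)]) (auto simp: C_def)
    ultimately show ?thesis using x(2) cs(2) by (auto simp: set_mult_def)
  qed
  moreover have "finite (T' <#> T)" "T' <#> T \<subseteq> carrier G"
  proof -
    have "T' <#> T = (\<lambda>(s, t). s \<otimes> t) ` (T' \<times> T)" by (auto simp: set_mult_def)
    then show "finite (T' <#> T)" using T(1) T'(1) by simp
    show "T' <#> T \<subseteq> carrier G"
      using T(2) T'(2) Zc by (intro set_mult_closed) auto
  qed
  ultimately show ?case
    unfolding L'_def[symmetric] by blast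
qed

text \<open>At the stage where the lower central series is trivial, the product of \<open>L\<close>
  with it is \<open>L\<close> itself.\<close>

lemma submonoid_finite_index_subgroup:
  assumes A: "finite A" "A \<subseteq> carrier G" "generate G A = carrier G"
    and nil: "lower_central G n = {\<one>}"
    and L: "submonoid L G"
    and van: "unbiased G (carrier G) L"
  shows "finite_index_subgroup L G"
proof -
  have "L <#> lower_central G n = L"
    unfolding nil using submonoid.mem_carrier[OF L] by (force simp: set_mult_def)
  then have pow: "\<And>g. g \<in> carrier G \<Longrightarrow> \<exists>m::nat. m > 0 \<and> g [^] m \<in> L"
    and exT: "\<exists>T. finite T \<and> T \<subseteq> carrier G \<and> (\<forall>g\<in>carrier G. \<exists>l\<in>L. \<exists>t\<in>T. g = l \<otimes> t)"
    using submonoid_mod_lower_central[OF A L van, of n] by simp_all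
  from exT obtain T where T: "finite T" "T \<subseteq> carrier G"
    "\<And>g. g \<in> carrier G \<Longrightarrow> \<exists>l\<in>L. \<exists>t\<in>T. g = l \<otimes> t" by blast
  have sub: "subgroup L G"
    using submonoid_positive_powers_subgroup[OF subgroup_self L submonoid.subset[OF L] pow] .
  have "rcosets L \<subseteq> (\<lambda>t. L #> t) ` T"
  proof
    fix X assume "X \<in> rcosets L"
    then obtain g where g: "g \<in> carrier G" "X = L #> g" by (auto simp: RCOSETS_def)
    obtain l t where lt: "l \<in> L" "t \<in> T" "g = l \<otimes> t" using T(3)[OF g(1)] by blast
    have "g \<in> L #> t" using lt by (auto simp: r_coset_def)
    then have "L #> t = L #> g"
      using repr_independence[OF _ _ sub] lt(2) T(2) by blast
    then show "X \<in> (\<lambda>t. L #> t) ` T" using g lt by blast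
  qed
  then have "finite (rcosets L)" using T(1) finite_surj by blast
  then show ?thesis using sub by (simp add: finite_index_subgroup_def)
qed

end

section \<open>Linear forms and convexity\<close>

text \<open>Both sides say that no hyperplane through the origin has all of \<open>A\<close> on one
  closed side. The converse separates \<open>0\<close> from the interior of the hull, with a
  degenerate case if this interior is empty.\<close>

lemma ball_subset_convex_hull_iff:
  fixes A :: "'v::euclidean_space set"
  shows "(\<exists>\<epsilon>>0. ball 0 \<epsilon> \<subseteq> convex hull A) \<longleftrightarrow> (\<forall>a. a \<noteq> 0 \<longrightarrow> (\<exists>x\<in>A. a \<bullet> x < 0))"
proof (intro iffI allI impI)
  fix a :: 'v assume "\<exists>\<epsilon>>0. ball 0 \<epsilon> \<subseteq> convex hull A" and a: "a \<noteq> 0"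
  then obtain \<epsilon> where \<epsilon>: "\<epsilon> > 0" "ball 0 \<epsilon> \<subseteq> convex hull A" by blast
  show "\<exists>x\<in>A. a \<bullet> x < 0"
  proof (rule ccontr)
    assume "\<not> ?thesis"
    then have "convex hull A \<subseteq> {x. a \<bullet> x \<ge> 0}"
      by (intro hull_minimal convex_halfspace_ge) (auto simp: not_less)
    moreover have "(- (\<epsilon> / (2 * norm a))) *\<^sub>R a \<in> ball 0 \<epsilon>"
      using \<epsilon> a by (simp add: dist_norm)
    ultimately have "a \<bullet> ((- (\<epsilon> / (2 * norm a))) *\<^sub>R a) \<ge> 0" using \<epsilon> by blast
    moreover have "\<epsilon> / (2 * norm a) * (a \<bullet> a) > 0" using \<epsilon> a by simp
    ultimately show False by simp
  qed
next
  assume neg: "\<forall>a. a \<noteq> 0 \<longrightarrow> (\<exists>x\<in>A. a \<bullet> x < 0)"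
  have sub: "A \<subseteq> convex hull A" by (rule hull_subset)
  have "0 \<in> interior (convex hull A)"
  proof (rule ccontr)
    assume no: "0 \<notin> interior (convex hull A)"
    show False
    proof (cases "interior (convex hull A) = {}")
      case True
      then obtain a b where ab: "a \<noteq> 0" "convex hull A \<subseteq> {x. a \<bullet> x = b}"
        using empty_interior_subset_hyperplane[OF convex_convex_hull True] by blast
      \<comment> \<open>The hypothesis for \<open>a\<close> and \<open>- a\<close> gives points on
        which the form has opposite signs, while it is constant on \<open>A\<close>.\<close>
      obtain x y where "x \<in> A" "a \<bullet> x < 0" "y \<in> A" "(- a) \<bullet> y < 0"
        using neg ab(1) by (metis neg_equal_0_iff_equal)
      moreover from this have "a \<bullet> x = b" "a \<bullet> y = b" using ab(2) sub by auto
      ultimately show False by simp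
    next
      case False
      obtain a where a: "a \<noteq> 0" "\<And>x. x \<in> interior (convex hull A) \<Longrightarrow> 0 \<le> a \<bullet> x"
        using separating_hyperplane_set_0[OF convex_interior[OF convex_convex_hull] no] by blast
      \<comment> \<open>Separation controls only the interior; a convex set with non-empty interior
        is contained in the closure of that interior.\<close>
      have "closure (interior (convex hull A)) \<subseteq> {x. a \<bullet> x \<ge> 0}"
        using a(2) by (intro closure_minimal closed_halfspace_ge) auto
      moreover have "A \<subseteq> closure (interior (convex hull A))"
        using convex_closure_interior[OF convex_convex_hull False] sub closure_subset by blast
      ultimately show False using neg a(1) by force
    qed
  qed
  then show "\<exists>\<epsilon>>0. ball 0 \<epsilon> \<subseteq> convex hull A" by (simp add: mem_interior)
qed

lemma real_vec_nth [simp]: "real_vec v $ i = real_of_int (v $ i)"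
  by (simp add: real_vec_def)

lemma real_vec_add: "real_vec (v + w) = real_vec v + real_vec w"
  by (simp add: vec_eq_iff)

lemma real_vec_axis: "real_vec (axis i 1) = axis i 1"
  by (simp add: vec_eq_iff axis_def)

lemma linear_form_inner: "linear_form (\<lambda>v. a \<bullet> real_vec v)"
  unfolding linear_form_def
  by (intro exI[of _ "\<lambda>x. a \<bullet> x"] conjI allI bounded_linear.linear[OF bounded_linear_inner_right] refl)

lemma linear_form_add: "linear_form f \<Longrightarrow> f (v + w) = f v + f w"
  by (auto simp: linear_form_def real_vec_add linear_add)

text \<open>An additive function is determined by its values at the standard basis vectors, which
  are the coordinates of the representing vector.\<close>

lemma additive_linear_form:
  fixes f :: "int ^ 'r \<Rightarrow> real"
  assumes add: "\<And>v w. f (v + w) = f v + f w"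
  shows "linear_form f"
proof -
  define a :: "real ^ 'r" where "a = (\<chi> i. f (axis i 1))"
  have zero: "f 0 = 0" using add[of 0 0] by simp
  have f_nat: "f (int n *s u) = real n * f u" for n u
  proof (induction n)
    case 0
    then show ?case by (simp add: zero)
  next
    case (Suc n)
    have "int (Suc n) *s u = u + int n *s u" by (simp add: vec_eq_iff algebra_simps)
    then show ?case using Suc add[of u "int n *s u"] by (simp add: algebra_simps)
  qed
  have f_int: "f (k *s u) = of_int k * f u" for k u
  proof (cases "k \<ge> 0")
    case True
    then show ?thesis using f_nat[of "nat k" u] by simp
  next
    case False
    have "k *s u + (- k) *s u = 0" by (simp add: vec_eq_iff)
    then have "f (k *s u) + f ((- k) *s u) = 0" using add zero by metis
    then show ?thesis using f_nat[of "nat (- k)" u] False by simp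
  qed
  have f_sum: "f (\<Sum>i\<in>I. g i) = (\<Sum>i\<in>I. f (g i))" if "finite I" for I :: "'r set" and g
    using that by induction (simp_all add: zero add)
  have "f v = a \<bullet> real_vec v" for v
  proof -
    have "f v = f (\<Sum>i\<in>UNIV. (v $ i) *s axis i 1)" by (simp add: basis_expansion)
    also have "\<dots> = a \<bullet> real_vec v"
      by (simp add: f_sum f_int a_def inner_vec_def mult.commute)
    finally show ?thesis .
  qed
  then show ?thesis using linear_form_inner[of a] by presburger
qed

text \<open>Every functional is an inner product, and a non-zero vector gives a form that is
  non-zero on integer vectors because the standard basis is integral.\<close>

lemma cond_real_forms_iff_inner:
  fixes \<psi> :: "'a set \<Rightarrow> int ^ 'r"
  shows "cond_real_forms G \<psi> S \<longleftrightarrow>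
    (\<forall>a. a \<noteq> 0 \<longrightarrow> (\<exists>s\<in>S. a \<bullet> real_vec (quotient_map G \<psi> s) < 0))"
proof (intro iffI allI impI)
  fix a :: "real ^ 'r" assume c: "cond_real_forms G \<psi> S" and "a \<noteq> 0"
  then obtain i where "a $ i \<noteq> 0" by (auto simp: vec_eq_iff)
  then have "a \<bullet> real_vec (axis i 1) \<noteq> 0" by (simp add: real_vec_axis inner_axis)
  then show "\<exists>s\<in>S. a \<bullet> real_vec (quotient_map G \<psi> s) < 0"
    using c linear_form_inner[of a] unfolding cond_real_forms_def by blast
next
  assume a: "\<forall>a. a \<noteq> 0 \<longrightarrow> (\<exists>s\<in>S. a \<bullet> real_vec (quotient_map G \<psi> s) < 0)"
  show "cond_real_forms G \<psi> S"
    unfolding cond_real_forms_def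
  proof (intro allI impI, elim conjE exE)
    fix f :: "int ^ 'r \<Rightarrow> real" and v assume "linear_form f" and v: "f v \<noteq> 0"
    then obtain L where L: "linear L" "\<And>v. f v = L (real_vec v)" by (auto simp: linear_form_def)
    have "f w = adjoint L 1 \<bullet> real_vec w" for w
      using adjoint_works[OF L(1), of "real_vec w" 1] L(2) by (simp add: inner_commute)
    moreover from this have "adjoint L 1 \<noteq> 0" using v by auto
    ultimately show "\<exists>s\<in>S. f (quotient_map G \<psi> s) < 0" using a by metis
  qed
qed

lemma cond_ball_iff_cond_real_forms: "cond_ball G \<psi> S \<longleftrightarrow> cond_real_forms G \<psi> S"
  unfolding cond_real_forms_iff_inner cond_ball_def ball_subset_convex_hull_iff by auto

section \<open>Integral forms for finite sets\<close>

lemma nonneg_int_vector_exists: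
  fixes a :: "real ^ 'r" and X :: "(int ^ 'r) set"
  assumes X: "finite X" and a: "a \<noteq> 0" and nonneg: "\<And>x. x \<in> X \<Longrightarrow> 0 \<le> a \<bullet> real_vec x"
  obtains p :: "int ^ 'r" where "p \<noteq> 0" "\<And>x. x \<in> X \<Longrightarrow> 0 \<le> (\<Sum>i\<in>UNIV. p $ i * x $ i)"
proof -
  obtain j where j: "a $ j \<noteq> 0" using a by (auto simp: vec_eq_iff)
  \<comment> \<open>The scaling keeps the rounded vector non-zero: coordinate \<open>j\<close> of
    \<open>q\<close> times \<open>b\<close> has absolute value \<open>q\<close>, too large to be
    rounded to \<open>0\<close>.\<close>
  define b where "b = (1 / \<bar>a $ j\<bar>) *\<^sub>R a"
  have bj: "\<bar>b $ j\<bar> = 1" using j by (simp add: b_def)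
  have b_nonneg: "0 \<le> b \<bullet> real_vec x" if "x \<in> X" for x
    using nonneg[OF that] by (simp add: b_def)
  \<comment> \<open>\<open>K\<close> bounds the coordinate sum of each vector in \<open>X\<close>,
    so coordinate errors below \<open>1 / N\<close> with \<open>N > K\<close> give a total error
    below 1.\<close>
  define K where "K = (\<Sum>x\<in>X. \<Sum>i\<in>UNIV. \<bar>real_of_int (x $ i)\<bar>)"
  have K_nonneg: "0 \<le> K" unfolding K_def by (intro sum_nonneg) auto
  obtain N :: nat where "real N > K" using reals_Archimedean2 by blast
  then have N: "N > 0" "K < real N" using K_nonneg by (auto intro: gr0I)
  obtain h where h: "bij_betw h {0..<CARD('r)} (UNIV :: 'r set)"
    using ex_bij_betw_nat_finite[of "UNIV :: 'r set"] by auto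
  obtain q p where q: "0 < q"
    and p: "\<And>i. i < CARD('r) \<Longrightarrow> \<bar>of_int q * b $ h i - of_int (p i)\<bar> < 1 / real N"
    using Dirichlet_approx_simult[OF N(1), of "CARD('r)" "\<lambda>i. b $ h i"] by metis
  define P :: "int ^ 'r" where "P = (\<chi> i. p (inv_into {0..<CARD('r)} h i))"
  have P: "\<bar>of_int q * b $ i - of_int (P $ i)\<bar> < 1 / real N" for i
  proof -
    have "inv_into {0..<CARD('r)} h i < CARD('r)" "h (inv_into {0..<CARD('r)} h i) = i"
      using bij_betw_inv_into_right[OF h, of i] inv_into_into[of i h "{0..<CARD('r)}"] h
      by (auto simp: bij_betw_def)
    then show ?thesis using p by (metis P_def vec_lambda_beta)
  qed
  have "P $ j \<noteq> 0"
  proof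
    assume "P $ j = 0"
    then have "of_int q < 1 / real N" using P[of j] q bj by (simp add: abs_mult)
    also have "\<dots> \<le> 1" using N(1) by simp
    finally show False using q by simp
  qed
  moreover have "0 \<le> (\<Sum>i\<in>UNIV. P $ i * x $ i)" if x: "x \<in> X" for x
  proof -
    have "of_int q * (b \<bullet> real_vec x) - of_int (\<Sum>i\<in>UNIV. P $ i * x $ i)
        = (\<Sum>i\<in>UNIV. (of_int q * b $ i - of_int (P $ i)) * of_int (x $ i))"
      by (simp add: inner_vec_def sum_distrib_left sum_subtractf algebra_simps)
    also have "\<dots> \<le> (\<Sum>i\<in>UNIV. 1 / real N * \<bar>of_int (x $ i)\<bar>)"
    proof (rule sum_mono)
      fix i
      have "(of_int q * b $ i - of_int (P $ i)) * of_int (x $ i)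
          \<le> \<bar>of_int q * b $ i - of_int (P $ i)\<bar> * \<bar>real_of_int (x $ i)\<bar>"
        by (metis abs_ge_self abs_mult)
      also have "\<dots> \<le> 1 / real N * \<bar>of_int (x $ i)\<bar>"
        using P[of i] by (intro mult_right_mono) auto
      finally show "(of_int q * b $ i - of_int (P $ i)) * of_int (x $ i) \<le> 1 / real N * \<bar>of_int (x $ i)\<bar>" .
    qed
    also have "\<dots> = 1 / real N * (\<Sum>i\<in>UNIV. \<bar>of_int (x $ i)\<bar>)"
      by (simp add: sum_distrib_left)
    also have "\<dots> \<le> 1 / real N * K"
      unfolding K_def by (intro mult_left_mono member_le_sum[OF x]) (auto intro: sum_nonneg X)
    also have "\<dots> < 1" using N by (simp add: field_simps)
    finally have "of_int q * (b \<bullet> real_vec x) < of_int (\<Sum>i\<in>UNIV. P $ i * x $ i) + 1"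
      by linarith
    moreover have "0 \<le> of_int q * (b \<bullet> real_vec x)" using q b_nonneg[OF x] by simp
    ultimately have "real_of_int (\<Sum>i\<in>UNIV. P $ i * x $ i) > -1" by linarith
    then show ?thesis by linarith
  qed
  moreover have "P \<noteq> 0" using \<open>P $ j \<noteq> 0\<close> by auto
  ultimately show thesis using that by blast
qed

text \<open>An integral form is also a real one. Conversely, a real vector violating the condition
  is rounded to an integral one; this is where finiteness of \<open>S\<close> enters.\<close>

lemma cond_int_forms_iff_cond_real_forms:
  fixes \<psi> :: "'a set \<Rightarrow> int ^ 'r"
  assumes S: "finite S"
  shows "cond_int_forms G \<psi> S \<longleftrightarrow> cond_real_forms G \<psi> S"
proof
  assume c: "cond_real_forms G \<psi> S"
  show "cond_int_forms G \<psi> S"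
    unfolding cond_int_forms_def
  proof (intro allI impI, elim conjE exE)
    fix f :: "int ^ 'r \<Rightarrow> int" and v assume "linear_form (\<lambda>v. real_of_int (f v))" "f v \<noteq> 0"
    then have "\<exists>s\<in>S. real_of_int (f (quotient_map G \<psi> s)) < 0"
      using c[unfolded cond_real_forms_def, rule_format, of "\<lambda>v. real_of_int (f v)"] by auto
    then show "\<exists>s\<in>S. f (quotient_map G \<psi> s) < 0" by simp
  qed
next
  assume c: "cond_int_forms G \<psi> S"
  show "cond_real_forms G \<psi> S"
    unfolding cond_real_forms_iff_inner
  proof (intro allI impI, rule ccontr)
    fix a :: "real ^ 'r" assume a: "a \<noteq> 0" "\<not> (\<exists>s\<in>S. a \<bullet> real_vec (quotient_map G \<psi> s) < 0)"
    have fin: "finite (quotient_map G \<psi> ` S)" using S by simp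
    have nonneg: "0 \<le> a \<bullet> real_vec x" if "x \<in> quotient_map G \<psi> ` S" for x
      using a(2) that by (auto simp: not_less)
    obtain p :: "int ^ 'r" where p: "p \<noteq> 0"
      "\<And>x. x \<in> quotient_map G \<psi> ` S \<Longrightarrow> 0 \<le> (\<Sum>i\<in>UNIV. p $ i * x $ i)"
      using nonneg_int_vector_exists[OF fin a(1) nonneg] by blast
    define f where "f v = (\<Sum>i\<in>UNIV. p $ i * v $ i)" for v :: "int ^ 'r"
    have "(\<lambda>v. real_of_int (f v)) = (\<lambda>v. real_vec p \<bullet> real_vec v)"
      by (simp add: f_def inner_vec_def)
    then have "linear_form (\<lambda>v. real_of_int (f v))" by (simp add: linear_form_inner)
    moreover obtain j where "p $ j \<noteq> 0" using p(1) by (auto simp: vec_eq_iff)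
    then have "f (axis j 1) \<noteq> 0"
      by (simp add: f_def axis_def if_distrib[of "\<lambda>x. _ * x"] cong: if_cong)
    ultimately have "\<exists>s\<in>S. f (quotient_map G \<psi> s) < 0"
      using c unfolding cond_int_forms_def by blast
    then show False using p(2) by (auto simp: f_def not_less[symmetric])
  qed
qed

section \<open>Homomorphisms to the reals\<close>

context group
begin

lemma hom_additive_group_iff:
  "\<phi> \<in> hom G (additive_group :: real monoid) \<longleftrightarrow> additive_on G (carrier G) \<phi>"
  by (auto simp: hom_def additive_group_def additive_on_def)

section \<open>The isolator and homomorphisms through the quotient map\<close>

text \<open>The isolator is the preimage of the torsion subgroup of the abelianisation.\<close>

lemma commutator_isolator_normal: "commutator_isolator G \<lhd> G"
proof -
  let ?D = "derived G (carrier G)"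
  let ?K = "G Mod ?D"
  define h where "h x = ?D #> x" for x
  have nD: "?D \<lhd> G" by (rule derived_self_is_normal)
  note sD = normal_imp_subgroup[OF nD]
  interpret K: comm_group ?K by (rule derived_quot_is_comm_group)
  have "h \<in> hom G ?K"
    using normal.r_coset_hom_Mod[OF nD] by (simp add: h_def[abs_def])
  then interpret h: group_hom G ?K h
    by unfold_locales
  have h_one: "h x = \<one>\<^bsub>?K\<^esub> \<longleftrightarrow> x \<in> ?D" if "x \<in> carrier G" for x
    using coset_join1[of ?D x] coset_join2[of x ?D] that sD subgroup.subset[OF sD]
    by (auto simp: h_def)
  have iso: "x \<in> commutator_isolator G \<longleftrightarrow>
      x \<in> carrier G \<and> (\<exists>n::nat. n > 0 \<and> h x [^]\<^bsub>?K\<^esub> n = \<one>\<^bsub>?K\<^esub>)" for x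
    using h_one[of "x [^] (_::nat)"] h.hom_nat_pow[of x]
    unfolding isolator_def mem_Collect_eq by (metis nat_pow_closed)
  show ?thesis
  proof (rule normal_invI[OF subgroupI])
    show "commutator_isolator G \<subseteq> carrier G" by (auto simp: isolator_def)
    have "\<one> \<in> commutator_isolator G" 
      using subgroup.one_closed[OF sD] by (auto simp: isolator_def intro!: exI[of _ "1::nat"])
    then show "commutator_isolator G \<noteq> {}" by blast
    show "inv x \<in> commutator_isolator G" if x: "x \<in> commutator_isolator G" for x
    proof -
      obtain n :: nat where n: "x \<in> carrier G" "n > 0" "h x [^]\<^bsub>?K\<^esub> n = \<one>\<^bsub>?K\<^esub>"
        using x unfolding iso by blast
      have "h (inv x) [^]\<^bsub>?K\<^esub> n = \<one>\<^bsub>?K\<^esub>"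
        using n h.hom_inv[of x] K.nat_pow_inv[of "h x" n] h.hom_closed K.inv_one by metis
      then show ?thesis unfolding iso using n by blast
    qed
    show "x \<otimes> y \<in> commutator_isolator G"
      if xy: "x \<in> commutator_isolator G" "y \<in> commutator_isolator G" for x y
    proof -
      obtain n m :: nat where n: "x \<in> carrier G" "n > 0" "h x [^]\<^bsub>?K\<^esub> n = \<one>\<^bsub>?K\<^esub>"
        and m: "y \<in> carrier G" "m > 0" "h y [^]\<^bsub>?K\<^esub> m = \<one>\<^bsub>?K\<^esub>"
        using xy unfolding iso by blast
      have "h x [^]\<^bsub>?K\<^esub> (n * m) = \<one>\<^bsub>?K\<^esub>" "h y [^]\<^bsub>?K\<^esub> (n * m) = \<one>\<^bsub>?K\<^esub>"
        using n m K.nat_pow_pow[of "h x" n m] K.nat_pow_pow[of "h y" m n] K.nat_pow_one h.hom_closed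
        by (metis, metis mult.commute)
      then have "h (x \<otimes> y) [^]\<^bsub>?K\<^esub> (n * m) = \<one>\<^bsub>?K\<^esub>"
        using n m h.hom_mult[of x y] K.nat_pow_distrib[of "h x" "h y" "n * m"] h.hom_closed K.l_one[OF K.one_closed]
        by metis
      moreover have "n * m > 0" using n m by simp
      ultimately show ?thesis unfolding iso using n m by blast
    qed
    show "g \<otimes> x \<otimes> inv g \<in> commutator_isolator G"
      if "g \<in> carrier G" "x \<in> commutator_isolator G" for g x
    proof -
      have x: "x \<in> carrier G" using that by (auto simp: isolator_def)
      have "h (g \<otimes> x \<otimes> inv g) = h x"
        using that(1) x h.hom_mult[of "g \<otimes> x" "inv g"] h.hom_mult[of g x] h.hom_inv[of g]
          K.m_comm[of "h g" "h x"] K.m_assoc[of "h x" "h g" "inv\<^bsub>?K\<^esub> h g"] h.hom_closed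
          K.r_inv[of "h g"] K.r_one[of "h x"] K.inv_closed[of "h g"]
        by (metis inv_closed m_closed)
      then show ?thesis using that x iso by auto
    qed
  qed
qed

text \<open>Commutators are sent to 0, and the reals have no torsion.\<close>

lemma additive_on_commutator_isolator:
  assumes \<phi>: "additive_on G (carrier G) \<phi>" and x: "x \<in> commutator_isolator G"
  shows "\<phi> x = 0"
proof -
  have inv: "\<phi> (inv y) = - \<phi> y" if "y \<in> carrier G" for y
    using additive_on_inv[OF \<phi> subgroup_self that] .
  obtain n :: nat where n: "x \<in> carrier G" "n > 0" "x [^] n \<in> derived G (carrier G)"
    using x by (auto simp: isolator_def)
  have sub: "derived_set G (carrier G) \<subseteq> carrier G" by auto
  have "\<phi> (x [^] n) = 0"
  proof (rule additive_on_generate_eq_0[OF _ sub])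
    show "x [^] n \<in> generate G (derived_set G (carrier G))"
      using n(3) by (simp add: derived_def)
    show "additive_on G (generate G (derived_set G (carrier G))) \<phi>"
      using \<phi> generate_incl[OF sub] by (rule additive_on_mono)
    show "\<phi> c = 0" if "c \<in> derived_set G (carrier G)" for c
      using that by (auto simp: additive_onD[OF \<phi>] inv)
  qed
  then show ?thesis
    using additive_on_nat_pow[OF \<phi> subgroup_self n(1), of n] n(2) by simp
qed

lemma
  fixes \<psi> :: "'a set \<Rightarrow> int ^ 'r"
  assumes \<psi>: "\<psi> \<in> iso (G Mod commutator_isolator G) (additive_group :: (int ^ 'r) monoid)"
  shows quotient_map_mult: "x \<in> carrier G \<Longrightarrow> y \<in> carrier G \<Longrightarrow>
      quotient_map G \<psi> (x \<otimes> y) = quotient_map G \<psi> x + quotient_map G \<psi> y"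
    and quotient_map_surj: "\<exists>g\<in>carrier G. quotient_map G \<psi> g = v"
    and quotient_map_kernel: "x \<in> carrier G \<Longrightarrow> quotient_map G \<psi> x = 0 \<Longrightarrow> x \<in> commutator_isolator G"
proof -
  let ?I = "commutator_isolator G"
  note nI = commutator_isolator_normal
  note sI = normal_imp_subgroup[OF nI]
  have hom: "\<psi> (X <#> Y) = \<psi> X + \<psi> Y" if "X \<in> carrier (G Mod ?I)" "Y \<in> carrier (G Mod ?I)" for X Y
    using \<psi> that by (auto simp: iso_def hom_def additive_group_def)
  have bij: "bij_betw \<psi> (carrier (G Mod ?I)) UNIV"
    using \<psi> by (simp add: iso_def additive_group_def)
  have car: "?I #> x \<in> carrier (G Mod ?I)" if "x \<in> carrier G" for x
    using that by (simp add: carrier_FactGroup)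
  show mult: "quotient_map G \<psi> (x \<otimes> y) = quotient_map G \<psi> x + quotient_map G \<psi> y"
    if "x \<in> carrier G" "y \<in> carrier G" for x y
    using hom[OF car[OF that(1)] car[OF that(2)]] normal.rcos_sum[OF nI that]
    by (simp add: quotient_map_def)
  show "\<exists>g\<in>carrier G. quotient_map G \<psi> g = v"
    using bij by (auto simp: bij_betw_def carrier_FactGroup quotient_map_def image_image)
      (metis (no_types, lifting) UNIV_I imageE)
  show "x \<in> ?I" if x: "x \<in> carrier G" "quotient_map G \<psi> x = 0"
  proof -
    have "quotient_map G \<psi> \<one> = 0" using mult[of \<one> \<one>] by simp
    then have "\<psi> (?I #> \<one>) = \<psi> (?I #> x)" using x(2) by (simp add: quotient_map_def)
    then have "?I #> \<one> = ?I #> x"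
      by (rule inj_onD[OF bij_betw_imp_inj_on[OF bij] _ car[OF one_closed] car[OF x(1)]])
    then show ?thesis
      using repr_independenceD[OF sI, of x \<one>] x(1) subgroup.subset[OF sI] by simp
  qed
qed

text \<open>Homomorphisms to the reals vanish on the isolator, hence are exactly the linear forms
  composed with the quotient map.\<close>

lemma cond_real_forms_iff_cond_homs:
  fixes \<psi> :: "'a set \<Rightarrow> int ^ 'r"
  assumes \<psi>: "\<psi> \<in> iso (G Mod commutator_isolator G) (additive_group :: (int ^ 'r) monoid)"
    and S: "S \<subseteq> carrier G"
  shows "cond_real_forms G \<psi> S \<longleftrightarrow> cond_homs G S"
proof -
  let ?\<pi> = "quotient_map G \<psi>"
  note mult = quotient_map_mult[OF \<psi>] and surj = quotient_map_surj[OF \<psi>]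
    and ker = quotient_map_kernel[OF \<psi>]
  show ?thesis
  proof
    assume c: "cond_homs G S"
    show "cond_real_forms G \<psi> S"
      unfolding cond_real_forms_def
    proof (intro allI impI, elim conjE exE)
      fix f :: "int ^ 'r \<Rightarrow> real" and v assume f: "linear_form f" "f v \<noteq> 0"
      have hom: "(\<lambda>g. f (?\<pi> g)) \<in> hom G (additive_group :: real monoid)"
        unfolding hom_additive_group_iff additive_on_def by (simp add: mult linear_form_add[OF f(1)])
      have "\<exists>g\<in>carrier G. f (?\<pi> g) \<noteq> 0" using surj[of v] f(2) by auto
      then show "\<exists>s\<in>S. f (?\<pi> s) < 0" using bspec[OF c[unfolded cond_homs_def] hom] by simp
    qed
  next
    assume c: "cond_real_forms G \<psi> S"
    show "cond_homs G S"
      unfolding cond_homs_def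
    proof (intro ballI impI, elim bexE)
      fix \<phi> g assume \<phi>: "\<phi> \<in> hom G (additive_group :: real monoid)" and g: "g \<in> carrier G" "\<phi> g \<noteq> 0"
      have add: "additive_on G (carrier G) \<phi>" using \<phi> by (simp add: hom_additive_group_iff)
      \<comment> \<open>The chosen preimage does not matter, since two preimages differ by an
        element of the isolator.\<close>
      define f where "f v = \<phi> (SOME g. g \<in> carrier G \<and> ?\<pi> g = v)" for v
      have f: "f (?\<pi> x) = \<phi> x" if x: "x \<in> carrier G" for x
      proof -
        define y where "y = (SOME g. g \<in> carrier G \<and> ?\<pi> g = ?\<pi> x)"
        have y: "y \<in> carrier G" "?\<pi> y = ?\<pi> x"
          unfolding y_def by (rule someI2[of _ x], use x in auto)+
        have "?\<pi> (x \<otimes> inv y) + ?\<pi> y = ?\<pi> x"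
          using mult[of "x \<otimes> inv y" y] x y(1) by (simp add: m_assoc)
        then have "\<phi> (x \<otimes> inv y) = 0"
          using additive_on_commutator_isolator[OF add ker[of "x \<otimes> inv y"]] x y by simp
        then have "\<phi> x = \<phi> y"
          using additive_onD[OF add x, of "inv y"] additive_on_inv[OF add subgroup_self y(1)] y(1) by simp
        then show ?thesis by (simp add: f_def y_def)
      qed
      have "linear_form f"
      proof (rule additive_linear_form)
        fix v w
        obtain x y where "x \<in> carrier G" "?\<pi> x = v" "y \<in> carrier G" "?\<pi> y = w"
          using surj by meson
        then show "f (v + w) = f v + f w"
          using f mult additive_onD[OF add] m_closed by metis
      qed
      moreover have "\<exists>v. f v \<noteq> 0" using f g by metis
      ultimately have "\<exists>s\<in>S. f (?\<pi> s) < 0" using c unfolding cond_real_forms_def by blast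
      then show "\<exists>s\<in>S. \<phi> s < 0" using f S by (metis subsetD)
    qed
  qed
qed

section \<open>Finite index and the condition on homomorphisms\<close>

text \<open>By the pigeonhole principle two powers of \<open>g\<close> lie in the same
  coset.\<close>

lemma finite_index_positive_power:
  assumes H: "finite_index_subgroup H G" and g: "g \<in> carrier G"
  obtains n :: nat where "n > 0" "g [^] n \<in> H"
proof -
  have sH: "subgroup H G" and fin: "finite (rcosets H)"
    using H by (auto simp: finite_index_subgroup_def)
  have "range (\<lambda>n::nat. H #> g [^] n) \<subseteq> rcosets H"
    using g subgroup.subset[OF sH] by (auto intro!: rcosetsI)
  then have "\<not> inj (\<lambda>n::nat. H #> g [^] n)"
    using fin by (metis finite_subset finite_imageD infinite_UNIV_nat)
  then obtain i j :: nat where ij: "i < j" "H #> g [^] i = H #> g [^] j"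
    unfolding inj_def by (metis linorder_neqE_nat)
  have "g [^] j \<in> H #> g [^] i"
    using repr_independenceD[OF sH, of "g [^] j" "g [^] i"] ij g by simp
  then obtain x where x: "x \<in> H" "g [^] j = x \<otimes> g [^] i" by (auto simp: r_coset_def)
  have "g [^] (j - i) \<otimes> g [^] i = x \<otimes> g [^] i"
    using x(2) ij g by (simp add: nat_pow_mult)
  then have "g [^] (j - i) = x"
    using g subgroup.mem_carrier[OF sH x(1)] by (metis nat_pow_closed right_cancel)
  then show thesis using that[of "j - i"] x ij by simp
qed

lemma subsemigroup_generated_carrier:
  assumes "S \<subseteq> carrier G" "x \<in> subsemigroup_generated G S"
  shows "x \<in> carrier G"
  using assms(2) by induction (use assms(1) in auto)

text \<open>A homomorphism that is non-negative on a subgroup vanishes on it, and by finite index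
  some positive power of each element lies there.\<close>

lemma finite_index_imp_cond_homs:
  assumes S: "S \<subseteq> carrier G" and H: "finite_index_subgroup (subsemigroup_generated G S) G"
  shows "cond_homs G S"
  unfolding cond_homs_def
proof (intro ballI impI, elim bexE, rule ccontr)
  fix \<phi> g assume "\<phi> \<in> hom G (additive_group :: real monoid)" and g: "g \<in> carrier G" "\<phi> g \<noteq> 0"
    and no: "\<not> (\<exists>s\<in>S. \<phi> s < 0)"
  then have add: "additive_on G (carrier G) \<phi>" by (simp add: hom_additive_group_iff)
  let ?M = "subsemigroup_generated G S"
  have sM: "subgroup ?M G" using H by (simp add: finite_index_subgroup_def)
  have nonneg: "0 \<le> \<phi> x" if "x \<in> ?M" for x
    using that
  proof induction
    case (incl s)
    then show ?case using no by force
  next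
    case (mult x y)
    then show ?case
      using additive_onD[OF add] subgroup.mem_carrier[OF sM] by simp
  qed
  obtain n :: nat where n: "n > 0" "g [^] n \<in> ?M"
    using finite_index_positive_power[OF H g(1)] by blast
  have "0 \<le> \<phi> (g [^] n)" "0 \<le> \<phi> (inv (g [^] n))"
    using nonneg n(2) subgroup.m_inv_closed[OF sM] by auto
  then have "\<phi> (g [^] n) = 0"
    using additive_on_inv[OF add subgroup_self, of "g [^] n"] g(1) by simp
  then show False
    using additive_on_nat_pow[OF add subgroup_self g(1), of n] n(1) g(2) by simp
qed

text \<open>The identity is adjoined to obtain a submonoid. Once this is known to be a subgroup, the
  inverse of some \<open>s\<close> in \<open>S\<close> shows that the identity was already a product
  of elements of \<open>S\<close>.\<close>

lemma cond_homs_imp_finite_index: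
  assumes A: "finite A" "A \<subseteq> carrier G" "generate G A = carrier G"
    and nil: "lower_central G n = {\<one>}"
    and S: "S \<subseteq> carrier G" "S \<noteq> {}" and c: "cond_homs G S"
  shows "finite_index_subgroup (subsemigroup_generated G S) G"
proof -
  let ?M = "subsemigroup_generated G S"
  let ?L = "insert \<one> ?M"
  note Mc = subsemigroup_generated_carrier[OF S(1)]
  have L: "submonoid ?L G"
    by unfold_locales (use Mc in \<open>auto intro: subsemigroup_generated.mult\<close>)
  have "unbiased G (carrier G) ?L"
  proof (rule unbiasedI, rule ccontr)
    fix f x assume f: "additive_on G (carrier G) f" "x \<in> carrier G" "f x \<noteq> 0"
      and nonneg: "\<And>x. x \<in> ?L \<Longrightarrow> 0 \<le> f x"
    obtain s where s: "s \<in> S" "f s < 0"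
      using c f hom_additive_group_iff unfolding cond_homs_def by blast
    have "s \<in> ?L" using subsemigroup_generated.incl[OF s(1)] by blast
    then show False using nonneg[of s] s(2) by simp
  qed
  then have fi: "finite_index_subgroup ?L G"
    by (rule submonoid_finite_index_subgroup[OF A nil L])
  then have sL: "subgroup ?L G" by (simp add: finite_index_subgroup_def)
  have "\<one> \<in> ?M"
  proof -
    obtain s where s: "s \<in> S" using S(2) by blast
    have sM: "s \<in> ?M" using s by (rule subsemigroup_generated.incl)
    have "inv s \<in> ?L" using subgroup.m_inv_closed[OF sL, of s] sM by blast
    then consider "inv s = \<one>" | "inv s \<in> ?M" by blast
    then show ?thesis
    proof cases
      case 1
      then show ?thesis using sM Mc by (metis inv_inv inv_one)
    next
      case 2
      then show ?thesis
        using subsemigroup_generated.mult[OF sM 2] Mc[OF sM] by simp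
    qed
  qed
  then have "?L = ?M" by blast
  then show ?thesis using fi by simp
qed

end

theorem proposition19:
  fixes G :: "('a, 'b) monoid_scheme"
    and \<psi> :: "'a set \<Rightarrow> int ^ 'r"
    and S :: "'a set"
  assumes "finitely_generated_group G"
    and "nilpotent_group G"
    and "\<psi> \<in> iso (G Mod commutator_isolator G) (additive_group :: (int ^ 'r) monoid)"
    and "S \<subseteq> carrier G"
  shows "(cond_ball G \<psi> S \<longleftrightarrow> cond_real_forms G \<psi> S)
    \<and> (cond_real_forms G \<psi> S \<longleftrightarrow> cond_homs G S)
    \<and> (cond_homs G S \<longleftrightarrow> finite_index_subgroup (subsemigroup_generated G S) G)
    \<and> (finite S \<longrightarrow> (cond_int_forms G \<psi> S \<longleftrightarrow> cond_real_forms G \<psi> S))"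
proof -
  interpret group G using assms(2) by (simp add: nilpotent_group_def)
  obtain A where A: "finite A" "A \<subseteq> carrier G" "generate G A = carrier G"
    using assms(1) by (auto simp: finitely_generated_group_def)
  obtain n where nil: "lower_central G n = {\<one>\<^bsub>G\<^esub>}"
    using assms(2) by (auto simp: nilpotent_group_def)
  note real_homs = cond_real_forms_iff_cond_homs[OF assms(3,4)]
  \<comment> \<open>Here \<open>r \<ge> 1\<close> enters: there is a non-zero form, and the
    condition for it yields an element of \<open>S\<close>.\<close>
  have "S \<noteq> {}" if "cond_homs G S"
  proof -
    obtain i :: 'r where True by blast
    have "axis i 1 \<noteq> (0 :: real ^ 'r)" by (simp add: axis_eq_0_iff)
    then show ?thesis
      using that unfolding real_homs[symmetric] cond_real_forms_iff_inner by blast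
  qed
  then have "cond_homs G S \<longleftrightarrow> finite_index_subgroup (subsemigroup_generated G S) G"
    using cond_homs_imp_finite_index[OF A nil assms(4)] finite_index_imp_cond_homs[OF assms(4)]
    by blast
  then show ?thesis
    using cond_ball_iff_cond_real_forms[of G \<psi> S] real_homs
      cond_int_forms_iff_cond_real_forms[of S G \<psi>] by blast
qed

end
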